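(* Let $X$ and $Y$ be compact Hausdorff spaces, let $M$ be a self-conjugate subspace of $C(X)$, and let $S\subseteq M$ be a function space on $X$. Let $\{T_n\}_{n\in\mathbb N}$ be a sequence of positive linear maps $T_n:M\to C(Y)$, and let $T_\infty:M\to C(Y)$ be an isometry (not assumed linear) of $M$ onto a subspace $T_\infty(M)$ of $C(Y)$. Let $N:=\mathrm{Span}\bigcup_{1\le n\le\infty}T_n(M)\subseteq C(Y)$. Assume that $\|T_nf-T_\infty f\|\to0$ for every $f\in S$, that $Ch(N)\subseteq Ch(T_\infty(S))$, and that at least one of the sets $Ch(T_\infty(S))$, $Ch(N)$ is compact. Then $\|T_nf-T_\infty f\|\to0$ for every $f\in M$.
   Context: For a compact Hausdorff space $Z$, $C(Z)$ denotes the space of continuous scalar-valued functions on $Z$ (the scalars being either all real or all complex), with the supremum norm $\|\cdot\|$. A subspace $M\subseteq C(X)$ is self-conjugate if $\bar f\in M$ whenever $f\in M$. A function space on $X$ is a linear subspace of $C(X)$ containing the constant function $1$ and separating the points of $X$. A linear map $T:M\to C(Y)$ is positive if $Tf\ge 0$ whenever $f\ge 0$. An isometry means $\|T_\infty f-T_\infty g\|=\|f-g\|$ for all $f,g\in M$. For a linear subspace $A\subseteq C(Z)$, its Choquet boundary $Ch(A)$ is the set of points $z\in Z$ such that the evaluation functional $\delta_z:A\to$ scalars, $g\mapsto g(z)$, is an extreme point of the closed unit ball of the dual space of $(A,\|\cdot\|)$. *)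

theory Defs
  imports "HOL-Analysis.Analysis" "HOL-Library.Function_Algebras"
begin

text \<open>Compact Hausdorff spaces are modelled as types of class t2_space whose
  universe is compact. C(Z) is the set of continuous scalar-valued functions on Z;
  the scalar field 'k is real or complex (both cases are stated in the theorem).\<close>

definition cts :: "('z::topological_space \<Rightarrow> 'k::real_normed_vector) set" where
  "cts = {f. continuous_on UNIV f}"

definition supnorm :: "('z \<Rightarrow> 'k::real_normed_vector) \<Rightarrow> real" where
  "supnorm f = (SUP x. norm (f x))"

definition lin_subspace :: "('z \<Rightarrow> 'k::real_normed_field) set \<Rightarrow> bool" where
  "lin_subspace A \<longleftrightarrow> (\<lambda>x. 0) \<in> A \<and> (\<forall>f\<in>A. \<forall>g\<in>A. f + g \<in> A)
     \<and> (\<forall>c. \<forall>f\<in>A. (\<lambda>x. c * f x) \<in> A)"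

definition kspan :: "('z \<Rightarrow> 'k::real_normed_field) set \<Rightarrow> ('z \<Rightarrow> 'k) set" where
  "kspan A = \<Inter>{B. lin_subspace B \<and> A \<subseteq> B}"

definition self_conjugate :: "('k \<Rightarrow> 'k) \<Rightarrow> ('z \<Rightarrow> 'k) set \<Rightarrow> bool" where
  "self_conjugate cj M \<longleftrightarrow> (\<forall>f\<in>M. (\<lambda>x. cj (f x)) \<in> M)"

definition function_space :: "('z::topological_space \<Rightarrow> 'k::real_normed_field) set \<Rightarrow> bool" where
  "function_space S \<longleftrightarrow> lin_subspace S \<and> S \<subseteq> cts \<and> (\<lambda>x. 1) \<in> S
     \<and> (\<forall>x y. x \<noteq> y \<longrightarrow> (\<exists>f\<in>S. f x \<noteq> f y))"

definition nonneg_scalar :: "'k::real_normed_field \<Rightarrow> bool" where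
  "nonneg_scalar z \<longleftrightarrow> (\<exists>r::real. r \<ge> 0 \<and> z = of_real r)"

definition positive_on :: "('a \<Rightarrow> 'k::real_normed_field) set \<Rightarrow> (('a \<Rightarrow> 'k) \<Rightarrow> ('b \<Rightarrow> 'k)) \<Rightarrow> bool" where
  "positive_on M T \<longleftrightarrow> (\<forall>f\<in>M. (\<forall>x. nonneg_scalar (f x)) \<longrightarrow> (\<forall>y. nonneg_scalar (T f y)))"

definition linear_on :: "('a \<Rightarrow> 'k::real_normed_field) set \<Rightarrow> (('a \<Rightarrow> 'k) \<Rightarrow> ('b \<Rightarrow> 'k)) \<Rightarrow> bool" where
  "linear_on M T \<longleftrightarrow> (\<forall>f\<in>M. \<forall>g\<in>M. T (f + g) = T f + T g)
     \<and> (\<forall>c. \<forall>f\<in>M. T (\<lambda>x. c * f x) = (\<lambda>y. c * T f y))"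

definition isometry_on :: "('a \<Rightarrow> 'k::real_normed_field) set \<Rightarrow> (('a \<Rightarrow> 'k) \<Rightarrow> ('b \<Rightarrow> 'k)) \<Rightarrow> bool" where
  "isometry_on M T \<longleftrightarrow> (\<forall>f\<in>M. \<forall>g\<in>M. supnorm (T f - T g) = supnorm (f - g))"

text \<open>Closed unit ball of the dual of (A, sup norm); functionals are compared on A only.\<close>
definition dual_unit_ball :: "('z \<Rightarrow> 'k::real_normed_field) set \<Rightarrow> (('z \<Rightarrow> 'k) \<Rightarrow> 'k) set" where
  "dual_unit_ball A = {\<phi>. (\<forall>f\<in>A. \<forall>g\<in>A. \<phi> (f + g) = \<phi> f + \<phi> g)
      \<and> (\<forall>c. \<forall>f\<in>A. \<phi> (\<lambda>x. c * f x) = c * \<phi> f)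
      \<and> (\<forall>f\<in>A. norm (\<phi> f) \<le> supnorm f)}"

text \<open>Extreme point of the dual unit ball (elements of the dual identified when equal on A).\<close>
definition extreme_dual :: "('z \<Rightarrow> 'k::real_normed_field) set \<Rightarrow> (('z \<Rightarrow> 'k) \<Rightarrow> 'k) \<Rightarrow> bool" where
  "extreme_dual A \<phi> \<longleftrightarrow> \<phi> \<in> dual_unit_ball A \<and>
     (\<forall>\<psi>1\<in>dual_unit_ball A. \<forall>\<psi>2\<in>dual_unit_ball A. \<forall>t::real.
        0 < t \<and> t < 1 \<and> (\<forall>f\<in>A. \<phi> f = t *\<^sub>R \<psi>1 f + (1 - t) *\<^sub>R \<psi>2 f)
        \<longrightarrow> (\<forall>f\<in>A. \<psi>1 f = \<psi>2 f))"

definition choquet_boundary :: "('z \<Rightarrow> 'k::real_normed_field) set \<Rightarrow> 'z set" where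
  "choquet_boundary A = {z. extreme_dual A (\<lambda>g. g z)}"

text \<open>The claim of Theorem 3.2 for scalar field 'k with conjugation cj, spaces 'a (=X), 'b (=Y).
  T n for n :: nat are the maps T_1, T_2, ...; Tinf is T_infinity.\<close>
definition thm32_claim :: "('k::real_normed_field \<Rightarrow> 'k) \<Rightarrow> 'a::topological_space itself
    \<Rightarrow> 'b::topological_space itself \<Rightarrow> bool" where
  "thm32_claim cj _ _ \<longleftrightarrow>
    (\<forall>(M :: ('a \<Rightarrow> 'k) set) (S :: ('a \<Rightarrow> 'k) set) (T :: nat \<Rightarrow> ('a \<Rightarrow> 'k) \<Rightarrow> ('b \<Rightarrow> 'k))
       (Tinf :: ('a \<Rightarrow> 'k) \<Rightarrow> ('b \<Rightarrow> 'k)).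
      lin_subspace M \<and> M \<subseteq> cts \<and> self_conjugate cj M \<and>
      function_space S \<and> S \<subseteq> M \<and>
      (\<forall>n. linear_on M (T n) \<and> positive_on M (T n) \<and> T n ` M \<subseteq> cts) \<and>
      isometry_on M Tinf \<and> Tinf ` M \<subseteq> cts \<and> lin_subspace (Tinf ` M) \<and>
      (\<forall>f\<in>S. (\<lambda>n. supnorm (T n f - Tinf f)) \<longlonglongrightarrow> 0) \<and>
      choquet_boundary (kspan ((\<Union>n. T n ` M) \<union> Tinf ` M)) \<subseteq> choquet_boundary (Tinf ` S) \<and>
      (compact (choquet_boundary (Tinf ` S)) \<or>
       compact (choquet_boundary (kspan ((\<Union>n. T n ` M) \<union> Tinf ` M))))
      \<longrightarrow> (\<forall>f\<in>M. (\<lambda>n. supnorm (T n f - Tinf f)) \<longlonglongrightarrow> 0))"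

end

(* No representing measures are used.  The supremum norm of N = Span (T_n(M)) is attained on Ch(N):
   this is Krein-Milman and Milman in one step, by Zorn's lemma on closed extremal subsets of
   Y x {|l| = 1}.  So it suffices to prove uniform convergence on a compact K between Ch(N) and
   Ch(T_inf(S)).

   For y in Ch(T_inf(S)) the functional F = T_inf(-)(y) on S is positive and an extreme point of the
   dual ball.  Any positive extension H of F to C(X) satisfies H(v^2) = H(v)^2 for v in Re S, by
   extremality, so H vanishes on the squares (v - F(v))^2 and is therefore the evaluation at a point x.
   By Hahn-Banach every real continuous f is then the lower envelope at x of the functions
   Re s >= f with s in S.  This squeezes T_inf f(y) to f(x) (only the isometry property is used) and
   bounds T_n f near y by T_n s, which converges to T_inf s uniformly. *)

theory Submission
  imports Defs
begin

section \<open>The Hahn-Banach theorem for sublinear functionals\<close>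

text \<open>T_inf is given as an isometry only. On S it inherits linearity and positivity as a
  pointwise limit of the positive linear T_n, so the functionals T_inf(-)(y) are analysed on S
  alone, where extremality can be pulled back from T_inf(S). Passing from S to M must then work with
  distances, because on M there is no additivity of T_inf to rely on. Values at single boundary
  points would not give uniform convergence. Each boundary point therefore yields an estimate valid
  jointly for large n and for all nearby points, and compactness of K reduces these to finitely
  many. Extremal sets live in Y x {|l| = 1}, a pair (y, l) standing for the functional l times
  evaluation at y. Only compactness of Y and of the scalar unit sphere is used, and the dual ball
  never needs a topology. Order arguments (sublinear majorants, positive extensions, densities) are
  carried out on real parts. Multiplication by unit scalars converts the resulting one-sided real
  inequalities into scalar equalities.\<close>

definition sublinear :: "('v::real_vector \<Rightarrow> real) \<Rightarrow> bool" where
  "sublinear p \<longleftrightarrow> (\<forall>u v. p (u + v) \<le> p u + p v) \<and> (\<forall>a>0. \<forall>v. p (a *\<^sub>R v) \<le> a * p v)"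

lemma sublinear_add: "sublinear p \<Longrightarrow> p (u + v) \<le> p u + p v"
  by (simp add: sublinear_def)

lemma sublinear_zero:
  assumes "sublinear p" shows "p 0 = 0"
proof -
  have "p (2 *\<^sub>R 0) \<le> 2 * p 0" "p ((1/2) *\<^sub>R 0) \<le> (1/2) * p 0"
    using assms unfolding sublinear_def by (metis zero_less_numeral, metis half_gt_zero zero_less_one)
  then show ?thesis by simp
qed

lemma sublinear_scale:
  assumes p: "sublinear p" and "a \<ge> 0" shows "p (a *\<^sub>R v) = a * p v"
proof (cases "a = 0")
  case True
  then show ?thesis using sublinear_zero[OF p] by simp
next
  case False
  with \<open>a \<ge> 0\<close> have a: "a > 0" by simp
  have le: "p (b *\<^sub>R w) \<le> b * p w" if "b > 0" for b w
    using p that by (simp add: sublinear_def)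
  have "p ((1 / a) *\<^sub>R (a *\<^sub>R v)) \<le> (1 / a) * p (a *\<^sub>R v)"
    using a by (intro le) simp
  then have "a * p v \<le> p (a *\<^sub>R v)"
    using a by (simp add: field_simps)
  with le[OF a, of v] show ?thesis by simp
qed

lemma sublinear_minus:
  assumes "sublinear p" shows "- p (- v) \<le> p v"
  using sublinear_add[OF assms, of v "- v"] sublinear_zero[OF assms] by simp

text \<open>The support functional of the face of \<open>{G. G \<le> p}\<close> on which evaluation at \<open>v\<close> is maximal.\<close>

lemma sublinear_face:
  assumes p: "sublinear p"
  obtains q where "sublinear q" "\<And>w. q w \<le> p w" "q (- v) \<le> - p v"
proof -
  \<comment> \<open>With h = 1/t this is the difference quotient (p(v + h w) - p(v))/h, so
    \<open>q\<close> is the one-sided directional derivative of \<open>p\<close> at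
    \<open>v\<close>.\<close>
  define r where "r w t = p (w + t *\<^sub>R v) - t * p v" for w t
  define q where "q w = (INF t\<in>{0..}. r w t)" for w
  have lower: "- p (- w) \<le> r w t" if "t \<ge> 0" for w t
    using sublinear_add[OF p, of "w + t *\<^sub>R v" "- w"] sublinear_scale[OF p that, of v]
    by (simp add: r_def)
  have bdd: "bdd_below (r w ` {0..})" for w
    using lower by (intro bdd_belowI2) auto
  have q_le: "q w \<le> r w t" if "t \<ge> 0" for w t
    unfolding q_def using that by (intro cINF_lower bdd) simp
  have q_ge: "b \<le> q w" if "\<And>t. t \<ge> 0 \<Longrightarrow> b \<le> r w t" for b w
    unfolding q_def using that by (intro cINF_greatest) auto
  have r_add: "r (u + w) (s + t) \<le> r u s + r w t" for u w s t
    using sublinear_add[OF p, of "u + s *\<^sub>R v" "w + t *\<^sub>R v"]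
    by (simp add: r_def algebra_simps)
  have "q (u + w) \<le> q u + q w" for u w
  proof -
    have "q (u + w) - r w t \<le> q u" if "t \<ge> 0" for t
    proof (rule q_ge)
      fix s :: real assume "s \<ge> 0"
      with that have "q (u + w) \<le> r (u + w) (s + t)" by (intro q_le) simp
      with r_add[of u w s t] show "q (u + w) - r w t \<le> r u s" by simp
    qed
    then have "q (u + w) - q u \<le> q w" by (intro q_ge) (simp add: algebra_simps)
    then show ?thesis by simp
  qed
  moreover have "q (a *\<^sub>R w) \<le> a * q w" if "a > 0" for a w
  proof -
    have "q (a *\<^sub>R w) / a \<le> q w"
    proof (rule q_ge)
      fix t :: real assume "t \<ge> 0"
      with that have "q (a *\<^sub>R w) \<le> r (a *\<^sub>R w) (a * t)" by (intro q_le) simp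
      also have "\<dots> = a * r w t"
        using sublinear_scale[OF p less_imp_le[OF that], of "w + t *\<^sub>R v"]
        by (simp add: r_def algebra_simps)
      finally show "q (a *\<^sub>R w) / a \<le> r w t" using that by (simp add: field_simps)
    qed
    then show ?thesis using that by (simp add: field_simps)
  qed
  ultimately have "sublinear q" by (simp add: sublinear_def)
  moreover have "q w \<le> p w" for w
    using q_le[of 0 w] by (simp add: r_def)
  moreover have "q (- v) \<le> - p v"
    using q_le[of 1 "- v"] sublinear_zero[OF p] by (simp add: r_def)
  ultimately show thesis by (rule that)
qed

text \<open>The pointwise infimum of the chain works. It is finite because \<open>- p (- w)\<close>
  bounds every member from below, and subadditivity survives because of two members the smaller one
  bounds both: its value at \<open>u + w\<close> is at most \<open>r u + s w\<close>.\<close>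

lemma sublinear_Inf_chain:
  assumes "C \<noteq> {}" and sub: "\<And>r. r \<in> C \<Longrightarrow> sublinear r"
    and le: "\<And>r w. r \<in> C \<Longrightarrow> r w \<le> p w"
    and chain: "\<And>r s. r \<in> C \<Longrightarrow> s \<in> C \<Longrightarrow> r \<le> s \<or> s \<le> r"
  obtains q where "sublinear q" "\<And>r. r \<in> C \<Longrightarrow> q \<le> r"
proof -
  define q where "q w = (INF r\<in>C. r w)" for w
  have "- p (- w) \<le> r w" if "r \<in> C" for r w
    using sublinear_minus[OF sub[OF that], of w] le[OF that, of "- w"] by simp
  then have bdd: "bdd_below ((\<lambda>r. r w) ` C)" for w
    by (intro bdd_belowI2) auto
  have q_le: "q w \<le> r w" if "r \<in> C" for r w
    unfolding q_def using that by (intro cINF_lower bdd)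
  have q_ge: "b \<le> q w" if "\<And>r. r \<in> C \<Longrightarrow> b \<le> r w" for b w
    unfolding q_def using that \<open>C \<noteq> {}\<close> by (intro cINF_greatest) auto
  have "q (u + w) \<le> q u + q w" for u w
  proof -
    have "q (u + w) \<le> r u + s w" if rs: "r \<in> C" "s \<in> C" for r s
    proof -
      from chain[OF rs] obtain m where m: "m \<in> C" "m \<le> r" "m \<le> s"
        using rs by blast
      have "q (u + w) \<le> m u + m w"
        using q_le[OF m(1)] sublinear_add[OF sub[OF m(1)]] by (rule order_trans)
      also have "\<dots> \<le> r u + s w" using m(2,3) by (simp add: le_fun_def add_mono)
      finally show ?thesis .
    qed
    then have "q (u + w) - s w \<le> q u" if "s \<in> C" for s
      using that by (intro q_ge) (simp add: algebra_simps)
    then have "q (u + w) - q u \<le> q w" by (intro q_ge) (simp add: algebra_simps)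
    then show ?thesis by simp
  qed
  moreover have "q (a *\<^sub>R w) \<le> a * q w" if "a > 0" for a w
  proof -
    have "q (a *\<^sub>R w) / a \<le> q w"
    proof (rule q_ge)
      fix r assume r: "r \<in> C"
      then have "q (a *\<^sub>R w) \<le> a * r w"
        using q_le[OF r, of "a *\<^sub>R w"] sublinear_scale[OF sub[OF r], of a w] that by simp
      then show "q (a *\<^sub>R w) / a \<le> r w" using that by (simp add: field_simps)
    qed
    then show ?thesis using that by (simp add: field_simps)
  qed
  ultimately have "sublinear q" by (simp add: sublinear_def)
  then show thesis by (rule that) (simp add: le_fun_def q_le)
qed

text \<open>A minimal sublinear functional coincides with all of its face functionals, which makes it
  additive.\<close>

theorem Hahn_Banach_support:
  assumes p: "sublinear p"
  obtains G where "linear G" "\<And>w. G w \<le> p w" "G v = p v"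
proof -
  \<comment> \<open>Passing to the face at \<open>v\<close> before minimizing builds in the equality
    \<open>G v = p v\<close>: anything odd below \<open>p0\<close> is at least \<open>p v\<close> at
    \<open>v\<close>.\<close>
  obtain p0 where p0: "sublinear p0" "\<And>w. p0 w \<le> p w" "p0 (- v) \<le> - p v"
    using sublinear_face[OF p] by blast
  define A where "A = {q. sublinear q \<and> q \<le> p0}"
  have "\<exists>m\<in>A. \<forall>a\<in>A. m \<ge> a \<longrightarrow> a = m"
  proof (rule predicate_Zorn)
    show "partial_order_on A (relation_of (\<lambda>a b. a \<ge> b) A)"
      by (rule partial_order_on_relation_ofI) auto
    fix C assume C: "C \<in> Chains (relation_of (\<lambda>a b. a \<ge> b) A)"
    then have chain: "r \<le> s \<or> s \<le> r" and CA: "r \<in> A" if "r \<in> C" "s \<in> C" for r s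
      using that by (auto simp: Chains_def relation_of_def)
    show "\<exists>u\<in>A. \<forall>a\<in>C. a \<ge> u"
    proof (cases "C = {}")
      case True
      then show ?thesis using p0 by (auto simp: A_def)
    next
      case False
      obtain q where q: "sublinear q" "\<And>r. r \<in> C \<Longrightarrow> q \<le> r"
        using sublinear_Inf_chain[OF False _ _ chain, of p0] CA by (auto simp: A_def le_fun_def)
      moreover have "q \<le> p0" using False q(2) CA by (fastforce simp: A_def)
      ultimately show ?thesis by (auto simp: A_def)
    qed
  qed
  then obtain m where m: "sublinear m" "m \<le> p0"
    and minimal: "\<And>a. sublinear a \<Longrightarrow> a \<le> m \<Longrightarrow> a = m"
    unfolding A_def by auto
  have neg: "m (- w) = - m w" for w
  proof -
    obtain q where q: "sublinear q" "\<And>u. q u \<le> m u" "q (- w) \<le> - m w"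
      using sublinear_face[OF m(1)] by blast
    with minimal[of q] have "m (- w) \<le> - m w" by (auto simp: le_fun_def)
    with sublinear_minus[OF m(1), of w] show ?thesis by simp
  qed
  \<comment> \<open>Subadditivity at \<open>u, w\<close> gives one inequality; at
    \<open>- u, - w\<close>, combined with oddness, it gives the other.\<close>
  have "m (u + w) = m u + m w" for u w
    using sublinear_add[OF m(1), of u w] sublinear_add[OF m(1), of "- u" "- w"] neg[of "u + w"]
    by (simp add: neg)
  moreover have "m (a *\<^sub>R w) = a *\<^sub>R m w" for a w
    using sublinear_scale[OF m(1), of a w] sublinear_scale[OF m(1), of "- a" w]
      neg[of "a *\<^sub>R w"] by (cases "a \<ge> 0") simp_all
  ultimately have "linear m" by (intro linearI)
  moreover have "m w \<le> p w" for w
    using m(2) p0(2)[of w] by (meson le_funD order_trans)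
  moreover have "m v \<ge> p v"
    using m(2) p0(3) neg[of v] by (fastforce simp: le_fun_def dest: spec[of _ "- v"])
  ultimately show thesis using that[of m] by (meson order_antisym)
qed

section \<open>Real and complex scalars\<close>

text \<open>\<open>c\<close> plays the role of the imaginary unit; the real scalars are the instance \<open>c = 0\<close>.\<close>

locale scalars =
  fixes re :: "'k::{real_normed_field, heine_borel} \<Rightarrow> real" and cj :: "'k \<Rightarrow> 'k" and c :: 'k
  assumes re_add: "re (a + b) = re a + re b"
    and re_scale: "re (of_real r * z) = r * re z"
    and re_one: "re 1 = 1"
    and plus_cj: "z + cj z = of_real (2 * re z)"
    and c_cases: "c = 0 \<or> c * c = - 1"
    and norm_sq: "(norm z)\<^sup>2 = (re z)\<^sup>2 + (re (c * z))\<^sup>2"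
begin

lemma re_of_real: "re (of_real r) = r"
  using re_scale[of r 1] re_one by simp

lemma re_0: "re 0 = 0"
  using re_of_real[of 0] by simp

lemma re_minus: "re (- z) = - re z"
  using re_scale[of "- 1" z] by simp

lemma re_diff: "re (a - b) = re a - re b"
  using re_add[of a "- b"] by (simp add: re_minus)

lemma abs_re_le: "\<bar>re z\<bar> \<le> norm z"
  by (rule power2_le_imp_le) (simp_all add: norm_sq)

lemma norm_le_re: "norm z \<le> \<bar>re z\<bar> + \<bar>re (c * z)\<bar>"
  by (rule power2_le_imp_le) (simp_all add: norm_sq power2_sum)

lemma re_c: "re (c * of_real r) = 0"
proof -
  have "re c = 0"
    using c_cases
  proof
    assume cc: "c * c = - 1"
    then have "(norm c)\<^sup>2 = 1"
      by (metis norm_minus_cancel norm_mult norm_one power2_eq_square)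
    with norm_sq[of c] show ?thesis by (simp add: cc re_minus re_one)
  qed (simp add: re_0)
  then show ?thesis using re_scale[of r c] by (simp add: mult.commute)
qed

text \<open>The two real numbers are the coordinates of the scalar (for \<i> the second is minus the
  imaginary part). Hence an identity of real parts that holds for both \<open>f\<close> and
  \<open>c f\<close> is an identity of scalars.\<close>

lemma eq_iff_re: "z = w \<longleftrightarrow> re z = re w \<and> re (c * z) = re (c * w)"
proof -
  have "z = w \<longleftrightarrow> norm (z - w) ^ 2 = 0" by simp
  also have "\<dots> \<longleftrightarrow> re z = re w \<and> re (c * z) = re (c * w)"
    unfolding norm_sq by (simp add: algebra_simps re_diff sum_power2_eq_zero_iff)
  finally show ?thesis .
qed

lemma re_cc: "re (c * (c * z)) = re (c * c) * re z"
  using c_cases by (auto simp: mult.assoc[symmetric] re_0 re_minus re_one)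

lemma decomp: "z = of_real (re z) + c * of_real (re (- c * z))"
  unfolding eq_iff_re using c_cases
  by (auto simp: re_add re_diff re_of_real re_c algebra_simps re_cc re_minus re_one re_0)

text \<open>A norm becomes a real part after multiplication by a unit scalar; this is the bridge
  from real one-sided bounds to norm bounds.\<close>

lemma rotation:
  obtains l where "norm l = 1" "re (l * z) = norm z"
proof (cases "z = 0")
  case True
  then show thesis using that[of 1] by (simp add: re_0)
next
  case False
  then show thesis
    using that[of "of_real (norm z) / z"] by (simp add: norm_divide re_of_real)
qed

lemma bounded_linear_re: "bounded_linear re"
  by (rule bounded_linear_intro[of _ 1])
     (simp_all add: re_add re_scale scaleR_conv_of_real abs_re_le)

lemmas continuous_on_re [continuous_intros] =
  bounded_linear.continuous_on[OF bounded_linear_re]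

end

section \<open>Supremum norm and linear subspaces\<close>

lemma cts_bounded:
  fixes f :: "'z::topological_space \<Rightarrow> 'k::real_normed_vector"
  assumes "compact (UNIV :: 'z set)" "f \<in> cts"
  shows "bounded (range f)"
  using assms compact_continuous_image compact_imp_bounded unfolding cts_def by blast

lemma norm_le_supnorm:
  fixes f :: "'z::topological_space \<Rightarrow> 'k::real_normed_vector"
  assumes "compact (UNIV :: 'z set)" "f \<in> cts"
  shows "norm (f x) \<le> supnorm f"
  unfolding supnorm_def using cts_bounded[OF assms]
  by (intro cSUP_upper) (auto simp: bounded_iff intro: bdd_aboveI2)

lemma supnorm_le: "(\<And>x. norm (f x) \<le> B) \<Longrightarrow> supnorm f \<le> B"
  unfolding supnorm_def by (intro cSUP_least) auto

lemma supnorm_nonneg: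
  fixes f :: "'z::topological_space \<Rightarrow> 'k::real_normed_vector"
  assumes "compact (UNIV :: 'z set)" "f \<in> cts"
  shows "0 \<le> supnorm f"
  using norm_le_supnorm[OF assms] norm_ge_zero order_trans by blast

lemma supnorm_rotate:
  fixes f :: "'z \<Rightarrow> 'k::real_normed_field"
  shows "norm l = 1 \<Longrightarrow> supnorm (\<lambda>x. l * f x) = supnorm f"
  by (simp add: supnorm_def norm_mult)

lemma lin_subspace_add: "lin_subspace A \<Longrightarrow> f \<in> A \<Longrightarrow> g \<in> A \<Longrightarrow> f + g \<in> A"
  by (simp add: lin_subspace_def)

lemma lin_subspace_scale: "lin_subspace A \<Longrightarrow> f \<in> A \<Longrightarrow> (\<lambda>x. k * f x) \<in> A"
  by (simp add: lin_subspace_def)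

lemma lin_subspace_diff:
  assumes "lin_subspace A" "f \<in> A" "g \<in> A" shows "f - g \<in> A"
proof -
  have "f + (\<lambda>x. (- 1) * g x) \<in> A"
    using assms by (intro lin_subspace_add lin_subspace_scale)
  also have "f + (\<lambda>x. (- 1) * g x) = f - g" by (simp add: fun_eq_iff)
  finally show ?thesis .
qed

text \<open>Real-linear functionals, since weighting by a real density acts only on real parts. On a
  subspace the one-sided bound already controls the absolute value, \<open>f\<close> being
  replaceable by its negative.\<close>

definition real_dual_ball :: "('z \<Rightarrow> 'k::real_normed_field) set \<Rightarrow> (('z \<Rightarrow> 'k) \<Rightarrow> real) set" where
  "real_dual_ball A = {r. (\<forall>f\<in>A. \<forall>g\<in>A. r (f + g) = r f + r g)
      \<and> (\<forall>a. \<forall>f\<in>A. r (\<lambda>x. of_real a * f x) = a * r f) \<and> (\<forall>f\<in>A. r f \<le> supnorm f)}"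

context scalars
begin

text \<open>A real-linear functional \<open>r\<close> is the real part of the scalar-linear functional
  \<open>f \<mapsto> r f + c r(- c f)\<close>, of the same norm.\<close>

lemma real_dual_ball_lift:
  assumes A: "lin_subspace A" and r: "r \<in> real_dual_ball A"
  obtains \<psi> where "\<psi> \<in> dual_unit_ball A" "\<And>f. f \<in> A \<Longrightarrow> re (\<psi> f) = r f"
proof -
  have r_add: "r (f + g) = r f + r g" if "f \<in> A" "g \<in> A" for f g
    using r that by (simp add: real_dual_ball_def)
  have r_scale: "r (\<lambda>x. of_real a * f x) = a * r f" if "f \<in> A" for a f
    using r that by (simp add: real_dual_ball_def)
  have r_le: "r f \<le> supnorm f" if "f \<in> A" for f
    using r that by (simp add: real_dual_ball_def)
  note scale = lin_subspace_scale[OF A]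
  define \<psi> where "\<psi> f = of_real (r f) + c * of_real (r (\<lambda>x. (- c) * f x))" for f
  have re_\<psi>: "re (\<psi> f) = r f" for f
    by (simp add: \<psi>_def re_add re_of_real re_c)
  have neg: "r (\<lambda>x. - f x) = - r f" if "f \<in> A" for f
    using r_scale[OF that, of "- 1"] by simp
  have re_c\<psi>: "re (c * \<psi> f) = r (\<lambda>x. c * f x)" if f: "f \<in> A" for f
    using c_cases neg[OF scale[OF f, of c]] r_scale[OF f, of 0]
    by (auto simp: \<psi>_def re_add re_diff re_c distrib_left right_diff_distrib re_cc re_of_real
        re_minus re_one re_0)
  \<comment> \<open>Real linearity of \<open>r\<close> handles the real coordinates of
    \<open>k\<close>, and \<open>re_c\<psi>\<close> the factor \<open>c\<close>. The identity then
    yields both scalar homogeneity and, for unit \<open>k\<close>, the norm bound.\<close>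
  have re_k\<psi>: "re (k * \<psi> f) = r (\<lambda>x. k * f x)" if f: "f \<in> A" for k f
  proof -
    define a b where "a = re k" and "b = re (- c * k)"
    have k: "k = of_real a + c * of_real b"
      using decomp[of k] by (simp add: a_def b_def)
    have "re (k * \<psi> f) = re (of_real a * \<psi> f) + re (of_real b * (c * \<psi> f))"
      unfolding re_add[symmetric] k by (simp add: algebra_simps)
    also have "\<dots> = a * r f + b * r (\<lambda>x. c * f x)"
      unfolding re_scale by (simp add: re_\<psi> re_c\<psi>[OF f])
    also have "\<dots> = r (\<lambda>x. of_real a * f x) + r (\<lambda>x. of_real b * (c * f x))"
      by (simp add: r_scale[OF f] r_scale[OF scale[OF f]])
    also have "\<dots> = r ((\<lambda>x. of_real a * f x) + (\<lambda>x. of_real b * (c * f x)))"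
      by (intro r_add[symmetric] scale f)
    also have "(\<lambda>x. of_real a * f x) + (\<lambda>x. of_real b * (c * f x)) = (\<lambda>x. k * f x)"
      by (simp add: fun_eq_iff k algebra_simps)
    finally show ?thesis .
  qed
  have "\<psi> (f + g) = \<psi> f + \<psi> g" if "f \<in> A" "g \<in> A" for f g
  proof -
    have "(\<lambda>x. c * (f + g) x) = (\<lambda>x. c * f x) + (\<lambda>x. c * g x)"
      by (simp add: fun_eq_iff algebra_simps)
    then show ?thesis
      using that unfolding eq_iff_re[of "\<psi> (f + g)"]
      by (simp add: re_add distrib_left re_\<psi> re_c\<psi> lin_subspace_add[OF A] r_add scale)
  qed
  moreover have "\<psi> (\<lambda>x. k * f x) = k * \<psi> f" if f: "f \<in> A" for k f
    unfolding eq_iff_re[of "\<psi> (\<lambda>x. k * f x)"]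
    using re_k\<psi>[OF f, of k] re_k\<psi>[OF f, of "c * k"]
    by (simp add: re_\<psi> re_c\<psi>[OF scale[OF f]] mult.assoc)
  moreover have "norm (\<psi> f) \<le> supnorm f" if f: "f \<in> A" for f
  proof -
    obtain l where l: "norm l = 1" "re (l * \<psi> f) = norm (\<psi> f)" by (rule rotation)
    then show ?thesis
      using r_le[OF scale[OF f, of l]] supnorm_rotate[of l f] re_k\<psi>[OF f, of l] by simp
  qed
  ultimately show thesis
    by (intro that[of \<psi>]) (auto simp: dual_unit_ball_def re_\<psi>)
qed

text \<open>Extremality may be tested against real-linear functionals: both lift to the scalar dual
  ball, and the real convex combination, read at \<open>f\<close> and at \<open>c f\<close>, becomes
  a scalar one.\<close>

lemma extreme_dual_real:
  assumes A: "lin_subspace A" and ext: "extreme_dual A F"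
    and r: "r1 \<in> real_dual_ball A" "r2 \<in> real_dual_ball A" and t: "0 < t" "t < 1"
    and F: "\<And>f. f \<in> A \<Longrightarrow> re (F f) = t * r1 f + (1 - t) * r2 f"
    and "f \<in> A"
  shows "r1 f = r2 f"
proof -
  obtain \<psi>1 where \<psi>1: "\<psi>1 \<in> dual_unit_ball A" "\<And>f. f \<in> A \<Longrightarrow> re (\<psi>1 f) = r1 f"
    using real_dual_ball_lift[OF A r(1)] by blast
  obtain \<psi>2 where \<psi>2: "\<psi>2 \<in> dual_unit_ball A" "\<And>f. f \<in> A \<Longrightarrow> re (\<psi>2 f) = r2 f"
    using real_dual_ball_lift[OF A r(2)] by blast
  have "F f = t *\<^sub>R \<psi>1 f + (1 - t) *\<^sub>R \<psi>2 f" if f: "f \<in> A" for f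
  proof -
    have hom: "\<psi> (\<lambda>x. c * f x) = c * \<psi> f" if "\<psi> \<in> dual_unit_ball A" for \<psi>
      using that f by (simp add: dual_unit_ball_def)
    have "F \<in> dual_unit_ball A" using ext by (simp add: extreme_dual_def)
    then show ?thesis
      unfolding eq_iff_re[of "F f"]
      using F[OF f] F[OF lin_subspace_scale[OF A f, of c]]
        \<psi>1(2)[OF f] \<psi>1(2)[OF lin_subspace_scale[OF A f, of c]]
        \<psi>2(2)[OF f] \<psi>2(2)[OF lin_subspace_scale[OF A f, of c]]
      by (simp add: hom \<psi>1(1) \<psi>2(1) scaleR_conv_of_real re_add re_scale distrib_left
          mult.left_commute[of c] del: of_real_diff)
  qed
  with ext \<psi>1(1) \<psi>2(1) t have "\<psi>1 f = \<psi>2 f"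
    using \<open>f \<in> A\<close> unfolding extreme_dual_def by blast
  then show ?thesis
    using \<psi>1(2) \<psi>2(2) \<open>f \<in> A\<close> by metis
qed

end

section \<open>The Choquet boundary is norming\<close>

lemma convex_comb_eq_max:
  fixes x y m t :: real
  assumes "x \<le> m" "y \<le> m" "m = t * x + (1 - t) * y" "0 < t" "t < 1"
  shows "x = m"
proof -
  have "t * (m - x) = (1 - t) * (y - m)"
    using assms(3) by (simp add: algebra_simps)
  also have "\<dots> \<le> 0"
    using assms by (intro mult_nonneg_nonpos) simp_all
  finally show ?thesis
    using assms by (simp add: mult_le_0_iff)
qed

text \<open>Every finite intersection of members of a chain contains a member and so is nonempty;
  the finite intersection property inside one compact member \<open>S0\<close> does the
  rest.\<close>

lemma compact_chain_Inter:
  fixes F :: "'z::t2_space set set"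
  assumes "F \<noteq> {}" and comp: "\<And>S. S \<in> F \<Longrightarrow> compact S \<and> S \<noteq> {}"
    and chain: "\<And>S T. S \<in> F \<Longrightarrow> T \<in> F \<Longrightarrow> S \<subseteq> T \<or> T \<subseteq> S"
  shows "\<Inter>F \<noteq> {}"
proof -
  obtain S0 where S0: "S0 \<in> F" using \<open>F \<noteq> {}\<close> by blast
  have lower: "\<exists>m\<in>F. m \<subseteq> S0 \<inter> \<Inter>F'" if "finite F'" "F' \<subseteq> F" for F'
    using that
  proof (induction F')
    case empty
    then show ?case using S0 by auto
  next
    case (insert T F')
    then obtain m where m: "m \<in> F" "m \<subseteq> S0 \<inter> \<Inter>F'" by auto
    have "T \<in> F" using insert.prems by simp
    with chain[OF m(1)] consider "m \<subseteq> T" | "T \<subseteq> m" by blast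
    then show ?case
    proof cases
      case 1
      then show ?thesis using m by (intro bexI[of _ m]) simp_all
    next
      case 2
      with m(2) have "T \<subseteq> S0 \<inter> \<Inter>F'" by (rule order_trans[rotated])
      then show ?thesis using \<open>T \<in> F\<close> by (intro bexI[of _ T]) simp_all
    qed
  qed
  have "S0 \<inter> \<Inter>F' \<noteq> {}" if F': "finite F'" "F' \<subseteq> F" for F'
  proof -
    obtain m where m: "m \<in> F" "m \<subseteq> S0 \<inter> \<Inter>F'"
      using lower[OF F'] by (elim bexE)
    show ?thesis
    proof
      assume "S0 \<inter> \<Inter>F' = {}"
      with m comp[OF m(1)] show False by (simp only: subset_empty simp_thms)
    qed
  qed
  then have "S0 \<inter> \<Inter>F \<noteq> {}"
    using comp S0 compact_imp_closed by (rule_tac compact_imp_fip) blast+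
  then show ?thesis by blast
qed

section \<open>Extremal sets of rotated evaluations\<close>

context scalars
begin

definition pairing :: "('b::t2_space \<Rightarrow> 'k) \<Rightarrow> 'b \<times> 'k \<Rightarrow> real" where
  "pairing g z = re (snd z * g (fst z))"

lemma continuous_on_pairing:
  assumes "g \<in> cts" shows "continuous_on E (pairing g)"
proof -
  have "continuous_on UNIV g" using assms by (simp add: cts_def)
  from continuous_on_compose2[OF this continuous_on_fst[OF continuous_on_id]]
  have "continuous_on E (\<lambda>z. g (fst z))" by simp
  then show ?thesis
    unfolding pairing_def[abs_def] by (intro continuous_intros)
qed

text \<open>Measure-free version of Bauer's extremal sets: whenever the functional attached to a point
  of \<open>E\<close> is a convex combination of functionals in the unit ball, these are dominated by the
  support functional of \<open>E\<close>.\<close>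

definition extremal_set :: "('b::t2_space \<Rightarrow> 'k) set \<Rightarrow> ('b \<times> 'k) set \<Rightarrow> bool" where
  "extremal_set N E \<longleftrightarrow> compact E \<and> E \<noteq> {} \<and> E \<subseteq> UNIV \<times> sphere 0 1 \<and>
    (\<forall>z\<in>E. \<forall>\<psi>1\<in>dual_unit_ball N. \<forall>\<psi>2\<in>dual_unit_ball N. \<forall>t::real.
      0 < t \<and> t < 1 \<and> (\<forall>g\<in>N. g (fst z) = t *\<^sub>R \<psi>1 g + (1 - t) *\<^sub>R \<psi>2 g)
      \<longrightarrow> (\<forall>g\<in>N. \<exists>z'\<in>E. re (snd z * \<psi>1 g) \<le> pairing g z'))"

lemma extremal_setD:
  assumes "extremal_set N E" "z \<in> E" "\<psi>1 \<in> dual_unit_ball N" "\<psi>2 \<in> dual_unit_ball N"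
    and "0 < t" "t < 1" "\<And>g. g \<in> N \<Longrightarrow> g (fst z) = t *\<^sub>R \<psi>1 g + (1 - t) *\<^sub>R \<psi>2 g" "g \<in> N"
  obtains z' where "z' \<in> E" "re (snd z * \<psi>1 g) \<le> pairing g z'"
  using assms unfolding extremal_set_def by meson

text \<open>The supremum norm of a continuous \<open>g\<close> is attained at some \<open>x\<close>,
  and a suitable rotation of \<open>g x\<close> has that norm as real part. So a single pair
  dominates every functional in the unit ball.\<close>

lemma extremal_set_UNIV:
  fixes N :: "('b::t2_space \<Rightarrow> 'k) set"
  assumes Y: "compact (UNIV :: 'b set)" and N: "N \<subseteq> cts"
  shows "extremal_set N (UNIV \<times> sphere 0 1)"
  unfolding extremal_set_def
proof (intro conjI ballI allI impI)
  show "compact ((UNIV :: 'b set) \<times> sphere (0::'k) 1)"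
    by (intro compact_Times Y compact_sphere)
  have "(undefined, 1) \<in> (UNIV :: 'b set) \<times> sphere (0::'k) 1" by simp
  then show "(UNIV :: 'b set) \<times> sphere (0::'k) 1 \<noteq> {}" by blast
next
  fix z :: "'b \<times> 'k" and \<psi>1 g
  assume z: "z \<in> UNIV \<times> sphere 0 1" and "\<psi>1 \<in> dual_unit_ball N" "g \<in> N"
  then have "norm (\<psi>1 g) \<le> supnorm g" by (simp add: dual_unit_ball_def)
  moreover have "re (snd z * \<psi>1 g) \<le> norm (\<psi>1 g)"
    using abs_re_le[of "snd z * \<psi>1 g"] z by (auto simp: norm_mult)
  moreover have "\<exists>x. supnorm g = norm (g x)"
  proof -
    have "continuous_on UNIV (\<lambda>x. norm (g x))"
      using N \<open>g \<in> N\<close> by (auto simp: cts_def intro!: continuous_intros)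
    then obtain x where "\<And>y. norm (g y) \<le> norm (g x)"
      using continuous_attains_sup[OF Y, of "\<lambda>x. norm (g x)"] by auto
    then have "supnorm g \<le> norm (g x)" by (rule supnorm_le)
    moreover have "norm (g x) \<le> supnorm g"
      using norm_le_supnorm[OF Y] N \<open>g \<in> N\<close> by blast
    ultimately show ?thesis by (intro exI[of _ x]) simp
  qed
  then obtain x where "supnorm g = norm (g x)" ..
  moreover obtain l where "norm l = 1" "re (l * g x) = norm (g x)" by (rule rotation)
  ultimately show "\<exists>z'\<in>UNIV \<times> sphere 0 1. re (snd z * \<psi>1 g) \<le> pairing g z'"
    by (intro bexI[of _ "(x, l)"]) (auto simp: pairing_def)
qed simp

text \<open>At a point of the face both functionals of a convex combination must attain the maximum
  \<open>m\<close> of \<open>v\<close>. Domination within \<open>E\<close>, applied to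
  \<open>w + s v\<close> with \<open>s\<close> large, then pushes the dominating point towards the
  maximizers of \<open>v\<close>; compactness makes this exact.\<close>

lemma extremal_set_exposed:
  assumes N: "lin_subspace N" "N \<subseteq> cts" and E: "extremal_set N E" and v: "v \<in> N"
  shows "extremal_set N {z\<in>E. \<forall>z'\<in>E. pairing v z' \<le> pairing v z}"
proof -
  have cE: "compact E" "E \<noteq> {}" "E \<subseteq> UNIV \<times> sphere 0 1"
    using E by (auto simp: extremal_set_def)
  have cont: "continuous_on A (pairing g)" if "g \<in> N" for g A
    using continuous_on_pairing N(2) that by blast
  obtain z0 where z0: "z0 \<in> E" "\<And>z. z \<in> E \<Longrightarrow> pairing v z \<le> pairing v z0"
    using continuous_attains_sup[OF cE(1,2) cont[OF v]] by blast
  define m where "m = pairing v z0"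
  define E' where "E' = {z\<in>E. m \<le> pairing v z}"
  have eq: "{z\<in>E. \<forall>z'\<in>E. pairing v z' \<le> pairing v z} = E'"
    using z0 by (fastforce simp: E'_def m_def intro: order_trans)
  have closed_ge: "closed {z. a \<le> pairing g z}" if "g \<in> N" for a g
    by (intro closed_Collect_le continuous_intros cont that)
  have "compact E'"
    using compact_Int_closed[OF cE(1) closed_ge[OF v, of m]]
    by (simp add: E'_def Collect_conj_eq)
  moreover have "E' \<noteq> {}" "E' \<subseteq> UNIV \<times> sphere 0 1"
    using z0(1) cE(3) unfolding E'_def m_def by blast+
  moreover have "\<exists>z'\<in>E'. re (snd z * \<psi>1 w) \<le> pairing w z'"
    if z: "z \<in> E'" and \<psi>: "\<psi>1 \<in> dual_unit_ball N" "\<psi>2 \<in> dual_unit_ball N"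
      and t: "0 < t" "t < 1" and comb: "\<And>g. g \<in> N \<Longrightarrow> g (fst z) = t *\<^sub>R \<psi>1 g + (1 - t) *\<^sub>R \<psi>2 g"
      and w: "w \<in> N"
    for z \<psi>1 \<psi>2 w and t :: real
  proof -
    have zE: "z \<in> E" using z by (simp add: E'_def)
    have zm: "pairing v z = m"
      using z z0(2)[OF zE] unfolding E'_def m_def by simp
    have t': "0 < 1 - t" "1 - t < 1" using t by simp_all
    have comb': "g (fst z) = (1 - t) *\<^sub>R \<psi>2 g + (1 - (1 - t)) *\<^sub>R \<psi>1 g" if "g \<in> N" for g
      using comb[OF that] by simp
    \<comment> \<open>Extremality speaks of the first functional only; \<open>comb'\<close>
      exchanges the two roles so that \<psi>2 can be bounded as well.\<close>
    have dom: "\<exists>z'\<in>E. re (snd z * \<psi>1 g) \<le> pairing g z'" if "g \<in> N" for g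
      using extremal_setD[OF E zE \<psi> t comb that] by blast
    have "re (snd z * \<psi>1 v) \<le> m"
      using dom[OF v] z0 m_def order_trans by blast
    moreover have "re (snd z * \<psi>2 v) \<le> m"
    proof -
      obtain z' where "z' \<in> E" "re (snd z * \<psi>2 v) \<le> pairing v z'"
        using extremal_setD[OF E zE \<psi>(2,1) t' comb' v] by blast
      then show ?thesis using z0(2)[of z'] by (simp add: m_def)
    qed
    moreover have "m = t * re (snd z * \<psi>1 v) + (1 - t) * re (snd z * \<psi>2 v)"
    proof -
      have "snd z * v (fst z)
          = of_real t * (snd z * \<psi>1 v) + of_real (1 - t) * (snd z * \<psi>2 v)"
        by (subst comb[OF v]) (simp add: scaleR_conv_of_real algebra_simps)
      then have "re (snd z * v (fst z)) = t * re (snd z * \<psi>1 v) + (1 - t) * re (snd z * \<psi>2 v)"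
        by (simp only: re_add re_scale)
      then show ?thesis using zm by (simp add: pairing_def)
    qed
    ultimately have \<psi>v: "re (snd z * \<psi>1 v) = m"
      by (rule convex_comb_eq_max[OF _ _ _ t])
    define a where "a = re (snd z * \<psi>1 w)"
    have key: "\<exists>z'\<in>E. a + s * m \<le> pairing w z' + s * pairing v z'" for s :: real
    proof -
      have sv: "(\<lambda>x. of_real s * v x) \<in> N" by (rule lin_subspace_scale[OF N(1) v])
      define g where "g = w + (\<lambda>x. of_real s * v x)"
      have g: "g \<in> N" unfolding g_def by (intro lin_subspace_add N w sv)
      have "\<psi>1 g = \<psi>1 w + of_real s * \<psi>1 v"
        using \<psi>(1) w v sv by (simp add: dual_unit_ball_def g_def)
      then have 1: "re (snd z * \<psi>1 g) = a + s * m"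
        by (simp add: a_def \<psi>v[symmetric] distrib_left re_add mult.left_commute[of "snd z"] re_scale)
      have 2: "pairing g z' = pairing w z' + s * pairing v z'" for z'
        by (simp add: pairing_def g_def distrib_left re_add mult.left_commute[of "snd z'"] re_scale)
      show ?thesis using dom[OF g] by (simp add: 1 2)
    qed
    show ?thesis
    proof (rule ccontr)
      assume "\<not> ?thesis"
      then have "\<forall>z'\<in>E'. pairing w z' < a" unfolding a_def by (simp only: bex_simps not_le)
      then have small: "pairing w z' < a" if "z' \<in> E" "m \<le> pairing v z'" for z'
        by (rule bspec) (use that in \<open>simp add: E'_def\<close>)
      define C where "C = {z'\<in>E. a \<le> pairing w z'}"
      have cC: "compact C"
        using compact_Int_closed[OF cE(1) closed_ge[OF w, of a]]
        by (simp add: C_def Collect_conj_eq)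
      have in_C: "z' \<in> C" if "z' \<in> E" "a + s * m \<le> pairing w z' + s * pairing v z'" "s \<ge> 0" for z' s
      proof -
        have "s * pairing v z' \<le> s * m"
          using that(1,3) z0 by (intro mult_left_mono) (auto simp: m_def)
        with that show ?thesis by (simp add: C_def)
      qed
      have "C \<noteq> {}" using key[of 0] in_C[of _ 0] by auto
      then obtain z1 where z1: "z1 \<in> C" "\<And>z'. z' \<in> C \<Longrightarrow> pairing v z' \<le> pairing v z1"
        using continuous_attains_sup[OF cC _ cont[OF v]] by blast
      have pos: "m - pairing v z1 > 0"
        using small[of z1] z1(1) by (force simp: C_def)
      obtain z2 where z2: "\<And>z'. z' \<in> E \<Longrightarrow> pairing w z' \<le> pairing w z2"
        using continuous_attains_sup[OF cE(1,2) cont[OF w]] by blast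
      \<comment> \<open>On \<open>C\<close> the values of \<open>v\<close> stay below
        \<open>m\<close> by at least \<open>m - pairing v z1\<close>. This \<open>s\<close> makes
        the resulting loss larger than anything \<open>w\<close> can gain over \<open>a\<close> on
        \<open>E\<close>, the maximum of \<open>w\<close> there being attained at \<open>z2\<close>.
        The added 1 makes the contradiction strict.\<close>
      define s where "s = (\<bar>pairing w z2 - a\<bar> + 1) / (m - pairing v z1)"
      have s: "s \<ge> 0" "s * (m - pairing v z1) = \<bar>pairing w z2 - a\<bar> + 1"
        using pos by (simp_all add: s_def)
      obtain z' where z': "z' \<in> E" "a + s * m \<le> pairing w z' + s * pairing v z'"
        using key by blast
      have "s * pairing v z' \<le> s * pairing v z1"
        by (intro mult_left_mono z1 in_C[OF z' s(1)] s(1))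
      with z' z2[OF z'(1)] s(2) show False by (simp add: algebra_simps)
    qed
  qed
  ultimately have "extremal_set N E'" unfolding extremal_set_def by blast
  then show ?thesis by (simp only: eq)
qed

text \<open>The dominating point may change from one member of the chain to the next. The dominating
  points within each member form a nonempty compact set, and these sets are again a chain, so a
  common one exists.\<close>

lemma extremal_set_Inter:
  assumes N: "N \<subseteq> cts" and "C \<noteq> {}" and ext: "\<And>E. E \<in> C \<Longrightarrow> extremal_set N E"
    and chain: "\<And>E F. E \<in> C \<Longrightarrow> F \<in> C \<Longrightarrow> E \<subseteq> F \<or> F \<subseteq> E"
  shows "extremal_set N (\<Inter>C)"
proof -
  have C: "compact E" "E \<noteq> {}" "E \<subseteq> UNIV \<times> sphere 0 1" if "E \<in> C" for E
    using ext[OF that] by (auto simp: extremal_set_def)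
  have "\<Inter>C \<noteq> {}"
    using C chain by (intro compact_chain_Inter \<open>C \<noteq> {}\<close>) auto
  moreover have "\<Inter>C \<subseteq> UNIV \<times> sphere 0 1" using C(3) \<open>C \<noteq> {}\<close> by blast
  moreover have "compact (\<Inter>C)"
  proof -
    obtain E where E: "E \<in> C" using \<open>C \<noteq> {}\<close> by blast
    have "compact (E \<inter> \<Inter>C)"
      using C(1) compact_imp_closed by (intro compact_Int_closed C(1) E closed_Inter) blast
    then show ?thesis using E by (simp add: Inf_lower inf_absorb2)
  qed
  moreover have "\<exists>z'\<in>\<Inter>C. re (snd z * \<psi>1 g) \<le> pairing g z'"
    if z: "z \<in> \<Inter>C" and \<psi>: "\<psi>1 \<in> dual_unit_ball N" "\<psi>2 \<in> dual_unit_ball N"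
      and t: "0 < t" "t < 1" and comb: "\<And>g. g \<in> N \<Longrightarrow> g (fst z) = t *\<^sub>R \<psi>1 g + (1 - t) *\<^sub>R \<psi>2 g"
      and g: "g \<in> N"
    for z \<psi>1 \<psi>2 g and t :: real
  proof -
    define P where "P = {z'. re (snd z * \<psi>1 g) \<le> pairing g z'}"
    have "closed P"
      unfolding P_def using N g by (intro closed_Collect_le continuous_intros continuous_on_pairing) auto
    then have comp: "compact (E \<inter> P)" if "E \<in> C" for E
      using C(1)[OF that] by (rule compact_Int_closed[rotated])
    have nonempty: "E \<inter> P \<noteq> {}" if E: "E \<in> C" for E
    proof -
      have "z \<in> E" using z E by (rule InterD)
      then show ?thesis
        using extremal_setD[OF ext[OF E] _ \<psi> t comb g] unfolding P_def by blast
    qed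
    have "\<Inter>((\<lambda>E. E \<inter> P) ` C) \<noteq> {}"
    proof (rule compact_chain_Inter)
      show "(\<lambda>E. E \<inter> P) ` C \<noteq> {}" using \<open>C \<noteq> {}\<close> by simp
      show "compact S \<and> S \<noteq> {}" if "S \<in> (\<lambda>E. E \<inter> P) ` C" for S
        using that comp nonempty by blast
      fix S T assume "S \<in> (\<lambda>E. E \<inter> P) ` C" "T \<in> (\<lambda>E. E \<inter> P) ` C"
      then obtain E F where "S = E \<inter> P" "T = F \<inter> P" "E \<in> C" "F \<in> C" by blast
      with chain[of E F] show "S \<subseteq> T \<or> T \<subseteq> S" by blast
    qed
    then show ?thesis using \<open>C \<noteq> {}\<close> by (auto simp: P_def)
  qed
  ultimately show ?thesis unfolding extremal_set_def by blast
qed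

text \<open>A minimal extremal set coincides with each of its exposed faces, so every pairing is
  constant on it and domination says that \<psi>1 lies below the rotated evaluation at
  \<open>z\<close>. Keeping the minimal set inside the face \<open>E0\<close> where \<open>g\<close>
  is maximal makes the resulting boundary point norming for \<open>g\<close>.\<close>

theorem choquet_boundary_norming:
  fixes N :: "('b::t2_space \<Rightarrow> 'k) set"
  assumes Y: "compact (UNIV :: 'b set)" and N: "lin_subspace N" "N \<subseteq> cts" and g: "g \<in> N"
  obtains y where "y \<in> choquet_boundary N" "supnorm g \<le> norm (g y)"
proof -
  define E0 where "E0 = {z\<in>(UNIV :: 'b set) \<times> sphere (0::'k) 1.
      \<forall>z'\<in>UNIV \<times> sphere 0 1. pairing g z' \<le> pairing g z}"
  have E0: "extremal_set N E0"
    unfolding E0_def by (intro extremal_set_exposed N extremal_set_UNIV Y g)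
  define A where "A = {E. extremal_set N E \<and> E \<subseteq> E0}"
  have "\<exists>m\<in>A. \<forall>a\<in>A. a \<subseteq> m \<longrightarrow> a = m"
  proof (rule predicate_Zorn)
    show "partial_order_on A (relation_of (\<lambda>a b. b \<subseteq> a) A)"
      by (rule partial_order_on_relation_ofI) auto
    fix C assume C: "C \<in> Chains (relation_of (\<lambda>a b. b \<subseteq> a) A)"
    then have chain: "r \<subseteq> s \<or> s \<subseteq> r" and CA: "r \<in> A" if "r \<in> C" "s \<in> C" for r s
      using that by (auto simp: Chains_def relation_of_def)
    show "\<exists>u\<in>A. \<forall>a\<in>C. u \<subseteq> a"
    proof (cases "C = {}")
      case True
      then show ?thesis using E0 by (auto simp: A_def)
    next
      case False
      then have "\<Inter>C \<in> A"
        using CA chain extremal_set_Inter[OF N(2) False] unfolding A_def by blast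
      then show ?thesis by blast
    qed
  qed
  then obtain E where "E \<in> A" and min: "\<forall>F\<in>A. F \<subseteq> E \<longrightarrow> F = E" by blast
  then have E: "extremal_set N E" "E \<subseteq> E0" by (simp_all add: A_def)
  have minimal: "F = E" if "extremal_set N F" "F \<subseteq> E" for F
    using min that E(2) by (auto simp: A_def)
  obtain z where z: "z \<in> E" using E(1) by (auto simp: extremal_set_def)
  then have nz: "norm (snd z) = 1" using E(1) by (auto simp: extremal_set_def)
  have const: "pairing v z' \<le> pairing v z" if "v \<in> N" "z' \<in> E" for v z'
    using minimal[OF extremal_set_exposed[OF N E(1) that(1)]] that(2) z by blast
  have "extreme_dual N (\<lambda>h. h (fst z))"
  proof -
    have ball: "(\<lambda>h. h (fst z)) \<in> dual_unit_ball N"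
      using norm_le_supnorm[OF Y] N(2) by (auto simp: dual_unit_ball_def)
    have eq: "\<psi>1 h = h (fst z)"
      if \<psi>: "\<psi>1 \<in> dual_unit_ball N" "\<psi>2 \<in> dual_unit_ball N" and t: "0 < t" "t < 1"
        and comb: "\<And>g. g \<in> N \<Longrightarrow> g (fst z) = t *\<^sub>R \<psi>1 g + (1 - t) *\<^sub>R \<psi>2 g" and h: "h \<in> N"
      for \<psi>1 \<psi>2 h and t :: real
    proof -
      have le: "re (snd z * \<psi>1 v) \<le> re (snd z * v (fst z))" if v: "v \<in> N" for v
      proof -
        obtain z' where "z' \<in> E" "re (snd z * \<psi>1 v) \<le> pairing v z'"
          using extremal_setD[OF E(1) z \<psi> t comb v] by blast
        with const[OF v] show ?thesis unfolding pairing_def by (meson order_trans)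
      qed
      define d where "d = \<psi>1 h - h (fst z)"
      \<comment> \<open>The bound \<open>le\<close> holds for all of \<open>N\<close>, so it may be
        applied to \<open>l h\<close>; this choice of \<open>l\<close> turns it into
        \<open>norm (snd z * d) \<le> 0\<close>.\<close>
      obtain l where l: "norm l = 1" "re (l * (snd z * d)) = norm (snd z * d)" by (rule rotation)
      have "\<psi>1 (\<lambda>x. l * h x) = l * \<psi>1 h"
        using \<psi>(1) h by (simp add: dual_unit_ball_def)
      then have "re (l * (snd z * d)) \<le> 0"
        using le[OF lin_subspace_scale[OF N(1) h, of l]]
        by (simp add: d_def right_diff_distrib re_diff mult.left_commute[of l])
      then have "d = 0" using l nz by (simp add: norm_mult)
      then show ?thesis by (simp add: d_def)
    qed
    show ?thesis
      unfolding extreme_dual_def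
    proof (intro conjI ball ballI allI impI)
      fix \<psi>1 \<psi>2 h and t :: real
      assume \<psi>: "\<psi>1 \<in> dual_unit_ball N" "\<psi>2 \<in> dual_unit_ball N" and h: "h \<in> N"
        and *: "0 < t \<and> t < 1 \<and> (\<forall>f\<in>N. f (fst z) = t *\<^sub>R \<psi>1 f + (1 - t) *\<^sub>R \<psi>2 f)"
      have "\<psi>1 h = h (fst z)" by (rule eq[OF \<psi> _ _ _ h, of t]) (use * in auto)
      moreover have "\<psi>2 h = h (fst z)" by (rule eq[OF \<psi>(2,1) _ _ _ h, of "1 - t"]) (use * in auto)
      ultimately show "\<psi>1 h = \<psi>2 h" by simp
    qed
  qed
  moreover have "supnorm g \<le> norm (g (fst z))"
  proof (rule supnorm_le)
    fix x
    obtain l where l: "norm l = 1" "re (l * g x) = norm (g x)" by (rule rotation)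
    have "pairing g (x, l) \<le> pairing g z"
      using z E(2) l(1) by (auto simp: E0_def)
    also have "\<dots> \<le> norm (g (fst z))"
      using abs_re_le[of "snd z * g (fst z)"] nz by (simp add: pairing_def norm_mult)
    finally show "norm (g x) \<le> norm (g (fst z))" by (simp add: pairing_def l(2))
  qed
  ultimately show thesis by (intro that[of "fst z"]) (simp_all add: choquet_boundary_def)
qed

end

section \<open>Extreme positive functionals\<close>

definition positive_functional :: "(('z::topological_space \<Rightarrow> real) \<Rightarrow> real) \<Rightarrow> bool" where
  "positive_functional H \<longleftrightarrow> (\<forall>f\<in>cts. \<forall>g\<in>cts. H (\<lambda>x. f x + g x) = H f + H g)
     \<and> (\<forall>a. \<forall>f\<in>cts. H (\<lambda>x. a * f x) = a * H f) \<and> (\<forall>f\<in>cts. (\<forall>x. 0 \<le> f x) \<longrightarrow> 0 \<le> H f)"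

lemma cts_real_intros [intro]:
  fixes f g :: "'z::topological_space \<Rightarrow> real"
  shows "(\<lambda>x. a) \<in> cts" "f \<in> cts \<Longrightarrow> g \<in> cts \<Longrightarrow> (\<lambda>x. f x + g x) \<in> cts"
    "f \<in> cts \<Longrightarrow> g \<in> cts \<Longrightarrow> (\<lambda>x. f x - g x) \<in> cts"
    "f \<in> cts \<Longrightarrow> g \<in> cts \<Longrightarrow> (\<lambda>x. f x * g x) \<in> cts" "f \<in> cts \<Longrightarrow> (\<lambda>x. - f x) \<in> cts"
  by (auto simp: cts_def intro!: continuous_intros)

context
  fixes H :: "('z::topological_space \<Rightarrow> real) \<Rightarrow> real"
  assumes H: "positive_functional H"
begin

lemma pf_add: "f \<in> cts \<Longrightarrow> g \<in> cts \<Longrightarrow> H (\<lambda>x. f x + g x) = H f + H g"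
  using H by (simp add: positive_functional_def)

lemma pf_scale: "f \<in> cts \<Longrightarrow> H (\<lambda>x. a * f x) = a * H f"
  using H by (simp add: positive_functional_def)

lemma pf_nonneg: "f \<in> cts \<Longrightarrow> (\<And>x. 0 \<le> f x) \<Longrightarrow> 0 \<le> H f"
  using H by (simp add: positive_functional_def)

lemma pf_diff: "f \<in> cts \<Longrightarrow> g \<in> cts \<Longrightarrow> H (\<lambda>x. f x - g x) = H f - H g"
  using pf_add[of f "\<lambda>x. - g x"] pf_scale[of g "- 1"] by (auto simp: cts_real_intros)

lemma pf_mono:
  assumes "f \<in> cts" "g \<in> cts" "\<And>x. f x \<le> g x" shows "H f \<le> H g"
  using pf_nonneg[of "\<lambda>x. g x - f x"] pf_diff[of g f] assms by (auto simp: cts_real_intros)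

lemma pf_const: "H (\<lambda>x. a) = a * H (\<lambda>x. 1)"
  using pf_scale[of "\<lambda>x. 1" a] by (auto simp: cts_real_intros)

text \<open>This replaces the statement that a compact set covered by open null sets is null for a
  measure: finitely many rescaled functions suffice, and their sum still has value 0 under
  \<open>H\<close>.\<close>

lemma pf_null_cover:
  assumes Z: "compact (UNIV :: 'z set)" and C: "closed C"
    and null: "\<And>x. x \<in> C \<Longrightarrow> \<exists>d\<in>cts. (\<forall>z. 0 \<le> d z) \<and> H d = 0 \<and> 0 < d x"
  obtains D where "D \<in> cts" "\<And>z. 0 \<le> D z" "\<And>x. x \<in> C \<Longrightarrow> 1 \<le> D x" "H D = 0"
proof -
  define A where "A = {d\<in>cts. (\<forall>z. 0 \<le> d z) \<and> H d = 0}"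
  have "compact C" using compact_Int_closed[OF Z C] by simp
  moreover have "open {z. 1 < d z}" if "d \<in> A" for d
    using that by (intro open_Collect_less continuous_intros) (simp add: A_def cts_def)
  moreover have "C \<subseteq> (\<Union>d\<in>A. {z. 1 < d z})"
  proof
    fix x assume "x \<in> C"
    then obtain d where d: "d \<in> cts" "\<forall>z. 0 \<le> d z" "H d = 0" "0 < d x" using null by blast
    \<comment> \<open>The factor gives the value 2 at \<open>x\<close>, hence values above 1 in a
      neighbourhood.\<close>
    then have "(\<lambda>z. (2 / d x) * d z) \<in> A"
      using pf_scale[of d "2 / d x"] cts_real_intros(4)[OF cts_real_intros(1) d(1), of "2 / d x"]
      by (simp add: A_def)
    moreover have "1 < (2 / d x) * d x" using d(4) by simp
    ultimately show "x \<in> (\<Union>d\<in>A. {z. 1 < d z})" by blast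
  qed
  ultimately obtain T where T: "T \<subseteq> A" "finite T" "C \<subseteq> (\<Union>d\<in>T. {z. 1 < d z})"
    by (rule compactE_image)
  have "\<exists>D\<in>A. \<forall>d\<in>T. \<forall>z. d z \<le> D z"
    using T(2,1)
  proof (induction T)
    case empty
    have "(\<lambda>z. 0) \<in> A" using pf_const[of 0] by (auto simp: A_def)
    then show ?case by auto
  next
    case (insert e T)
    then obtain D where D: "D \<in> A" "\<forall>d\<in>T. \<forall>z. d z \<le> D z" by auto
    have e: "e \<in> A" using insert.prems by simp
    have "(\<lambda>z. e z + D z) \<in> A"
      using D e pf_add[of e D] by (auto simp: A_def)
    moreover have "\<forall>d\<in>insert e T. \<forall>z. d z \<le> e z + D z"
    proof (intro ballI allI)
      fix d z assume "d \<in> insert e T"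
      moreover have "0 \<le> e z" "0 \<le> D z" using e D(1) by (simp_all add: A_def)
      ultimately show "d z \<le> e z + D z"
        using D(2) by (auto intro: add_increasing)
    qed
    ultimately show ?case by (intro bexI[of _ "\<lambda>z. e z + D z"])
  qed
  then obtain D where D: "D \<in> A" "\<And>d z. d \<in> T \<Longrightarrow> d z \<le> D z" by blast
  have "1 \<le> D x" if x: "x \<in> C" for x
  proof -
    obtain d where "d \<in> T" "1 < d x" using T(3) x by blast
    with D(2)[of d x] show ?thesis by simp
  qed
  with D(1) show thesis by (intro that[of D]) (auto simp: A_def)
qed

text \<open>Away from \<open>x\<close> everything is null, so \<open>f - f x\<close> counts only
  where it is smaller than \<open>e\<close>. On the closed set where it is not, it is dominated by
  \<open>B * D\<close> with \<open>H D = 0\<close>, which leaves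
  \<open>\<bar>H f - f x\<bar> \<le> e\<close>.\<close>

lemma pf_evaluation:
  assumes Z: "compact (UNIV :: 'z set)" and H1: "H (\<lambda>x. 1) = 1"
    and null: "\<And>z. z \<noteq> x \<Longrightarrow> \<exists>d\<in>cts. (\<forall>z. 0 \<le> d z) \<and> H d = 0 \<and> 0 < d z"
    and f: "f \<in> cts"
  shows "H f = f x"
proof -
  have "\<bar>H f - f x\<bar> \<le> e" if e: "e > 0" for e
  proof -
    define g where "g z = f z - f x" for z
    have g: "g \<in> cts" using f by (auto simp: g_def[abs_def])
    have Hg: "H g = H f - f x"
      using pf_diff[OF f, of "\<lambda>z. f x"] pf_const[of "f x"] H1 by (auto simp: g_def[abs_def])
    define C where "C = {z. e \<le> \<bar>g z\<bar>}"
    have "closed C"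
      unfolding C_def using g by (intro closed_Collect_le continuous_intros) (simp add: cts_def)
    moreover have "z \<noteq> x" if "z \<in> C" for z
      using that e by (auto simp: C_def g_def)
    ultimately obtain D where D: "D \<in> cts" "\<And>z. 0 \<le> D z" "\<And>x. x \<in> C \<Longrightarrow> 1 \<le> D x" "H D = 0"
      using pf_null_cover[OF Z, of C] null by blast
    define B where "B = supnorm g"
    have B: "\<bar>g z\<bar> \<le> B" "0 \<le> B" for z
      using norm_le_supnorm[OF Z g, of z] supnorm_nonneg[OF Z g] by (simp_all add: B_def)
    define m where "m z = e + B * D z" for z
    have m: "m \<in> cts" unfolding m_def[abs_def] by (intro cts_real_intros D(1))
    have Hm: "H m = e"
      using pf_add[OF cts_real_intros(1) cts_real_intros(4)[OF cts_real_intros(1) D(1)], of e B]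
        pf_const[of e] pf_scale[OF D(1), of B] D(4) H1
      by (simp add: m_def[abs_def])
    have "\<bar>g z\<bar> \<le> m z" for z
    proof (cases "z \<in> C")
      case True
      then have "B \<le> B * D z" using D(3)[OF True] B(2) by (simp add: mult_le_cancel_left1)
      with B(1)[of z] e show ?thesis by (simp add: m_def)
    next
      case False
      have "0 \<le> B * D z" using B(2) D(2) by simp
      with False show ?thesis by (simp add: m_def C_def)
    qed
    then have le: "g z \<le> m z" "(- 1) * g z \<le> m z" for z
      by (simp_all add: abs_le_iff)
    have "H g \<le> e" using pf_mono[OF g m le(1)] Hm by simp
    moreover have "- H g \<le> e"
      using pf_mono[OF cts_real_intros(4)[OF cts_real_intros(1) g] m le(2)] pf_scale[OF g, of "- 1"] Hm
      by simp
    ultimately show ?thesis using Hg by (simp add: abs_le_iff)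
  qed
  then have "\<bar>H f - f x\<bar> \<le> 0" by (rule field_le_epsilon) simp
  then show ?thesis by simp
qed

end

section \<open>Positive extensions of extreme functionals\<close>

context scalars
begin

lemma cts_re: "s \<in> cts \<Longrightarrow> (\<lambda>x. re (s x)) \<in> cts"
  by (auto simp: cts_def intro!: continuous_intros)

text \<open>The upper envelope \<open>U w\<close>, the infimum of \<open>re (F s)\<close> over
  \<open>re s \<ge> w\<close>, is sublinear, and any linear functional below it is positive and
  extends \<open>re F\<close>. Choosing one that touches \<open>U\<close> at \<open>f\<close> makes
  \<open>H f\<close> equal to this infimum, so \<open>H\<close> depends on \<open>f\<close>.\<close>

lemma positive_extension:
  fixes S :: "('a::topological_space \<Rightarrow> 'k) set" and f :: "'a \<Rightarrow> real"
  assumes X: "compact (UNIV :: 'a set)"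
    and S: "lin_subspace S" "S \<subseteq> cts" "(\<lambda>x. 1) \<in> S"
    and F: "F \<in> dual_unit_ball S" "F (\<lambda>x. 1) = 1"
    and pos: "\<And>s. s \<in> S \<Longrightarrow> (\<And>z. 0 \<le> re (s z)) \<Longrightarrow> 0 \<le> re (F s)"
    and f: "f \<in> cts"
  obtains H where "positive_functional H" "\<And>s. s \<in> S \<Longrightarrow> H (\<lambda>x. re (s x)) = re (F s)"
    "\<And>e. e > 0 \<Longrightarrow> \<exists>s\<in>S. (\<forall>z. f z \<le> re (s z)) \<and> re (F s) < H f + e"
proof -
  have F_add: "re (F (s + s')) = re (F s) + re (F s')" if "s \<in> S" "s' \<in> S" for s s'
    using F(1) that by (simp add: dual_unit_ball_def re_add)
  have F_scale: "re (F (\<lambda>x. of_real a * s x)) = a * re (F s)" if "s \<in> S" for a s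
    using F(1) that by (simp add: dual_unit_ball_def re_scale)
  have const: "(\<lambda>x. of_real a) \<in> S" "re (F (\<lambda>x. of_real a)) = a" for a
    using lin_subspace_scale[OF S(1,3), of "of_real a"] F_scale[OF S(3), of a] F(2)
    by (simp_all add: re_one)
  have mono: "re (F s) \<le> re (F s')" if "s \<in> S" "s' \<in> S" "\<And>z. re (s z) \<le> re (s' z)" for s s'
  proof -
    have "s' + (\<lambda>x. of_real (- 1) * s x) \<in> S"
      by (intro lin_subspace_add lin_subspace_scale S(1) that)
    then have "0 \<le> re (F (s' + (\<lambda>x. of_real (- 1) * s x)))"
      using that(3) by (intro pos) (simp_all add: re_diff)
    also have "\<dots> = re (F s') - re (F s)"
      using F_add[OF that(2) lin_subspace_scale[OF S(1) that(1)], of "of_real (- 1)"]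
        F_scale[OF that(1), of "- 1"] by simp
    finally show ?thesis by simp
  qed
  \<comment> \<open>Bounded continuous functions form a real vector space as a type, which the
    Hahn-Banach theorem requires; by compactness every function in \<open>cts\<close> belongs to
    it.\<close>
  define V where "V w = {re (F s) |s. s \<in> S \<and> (\<forall>z. apply_bcontfun w z \<le> re (s z))}"
    for w :: "'a \<Rightarrow>\<^sub>C real"
  define U where "U w = Inf (V w)" for w
  have bound: "apply_bcontfun w z \<le> norm w" "- norm w \<le> apply_bcontfun w z" for w :: "'a \<Rightarrow>\<^sub>C real" and z
    using norm_bounded[of w z] by (simp_all add: abs_le_iff)
  have nonempty: "V w \<noteq> {}" for w
    using const(1)[of "norm w"] bound(1) by (auto simp: V_def re_of_real intro!: exI[of _ "\<lambda>x. of_real (norm w)"])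
  have "- norm w \<le> v" if "v \<in> V w" for v w
  proof -
    obtain s where s: "v = re (F s)" "s \<in> S" "\<And>z. apply_bcontfun w z \<le> re (s z)"
      using \<open>v \<in> V w\<close> by (auto simp: V_def)
    have "re (F (\<lambda>x. of_real (- norm w))) \<le> re (F s)"
    proof (rule mono[OF const(1) s(2)])
      show "re (of_real (- norm w)) \<le> re (s z)" for z
        using order_trans[OF bound(2) s(3)] by (simp only: re_of_real)
    qed
    then show ?thesis by (simp only: const(2) s(1))
  qed
  then have bdd: "bdd_below (V w)" for w by (intro bdd_belowI)
  have U_le: "U w \<le> re (F s)" if "s \<in> S" "\<And>z. apply_bcontfun w z \<le> re (s z)" for w s
    unfolding U_def using that by (intro cInf_lower bdd) (auto simp: V_def)
  have U_less: "\<exists>s\<in>S. (\<forall>z. apply_bcontfun w z \<le> re (s z)) \<and> re (F s) < a" if "U w < a" for w a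
    using that cInf_lessD[OF nonempty, of w a] by (auto simp: U_def V_def)
  have "sublinear U"
    unfolding sublinear_def
  proof (intro conjI allI impI)
    fix v w :: "'a \<Rightarrow>\<^sub>C real"
    show "U (v + w) \<le> U v + U w"
    proof (rule field_le_epsilon)
      fix e :: real assume "e > 0"
      then obtain s s' where s: "s \<in> S" "\<forall>z. apply_bcontfun v z \<le> re (s z)" "re (F s) < U v + e / 2"
        and s': "s' \<in> S" "\<forall>z. apply_bcontfun w z \<le> re (s' z)" "re (F s') < U w + e / 2"
        using U_less[of v "U v + e / 2"] U_less[of w "U w + e / 2"] by auto
      have "U (v + w) \<le> re (F (s + s'))"
        using s s' by (intro U_le lin_subspace_add S(1)) (auto simp: re_add plus_bcontfun.rep_eq intro: add_mono)
      then show "U (v + w) \<le> U v + U w + e" using s s' by (simp add: F_add)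
    qed
  next
    fix a :: real and w :: "'a \<Rightarrow>\<^sub>C real"
    assume a: "a > 0"
    show "U (a *\<^sub>R w) \<le> a * U w"
    proof (rule field_le_epsilon)
      fix e :: real assume "e > 0"
      then have "U w < U w + e / a" using a by simp
      from U_less[OF this] obtain s
        where s: "s \<in> S" "\<forall>z. apply_bcontfun w z \<le> re (s z)" "re (F s) < U w + e / a" by blast
      have "U (a *\<^sub>R w) \<le> re (F (\<lambda>x. of_real a * s x))"
        using s a by (intro U_le lin_subspace_scale S(1)) (auto simp: re_scale scaleR_bcontfun.rep_eq)
      also have "\<dots> = a * re (F s)" by (rule F_scale[OF s(1)])
      also have "\<dots> \<le> a * (U w + e / a)" using s(3) a by simp
      also have "\<dots> = a * U w + e" using a by (simp add: field_simps)
      finally show "U (a *\<^sub>R w) \<le> a * U w + e" .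
    qed
  qed
  then obtain G where G: "linear G" "\<And>w. G w \<le> U w" "G (Bcontfun f) = U (Bcontfun f)"
    using Hahn_Banach_support[of U "Bcontfun f"] by blast
  define H where "H g = G (Bcontfun g)" for g
  have bc: "g \<in> bcontfun" if "g \<in> cts" for g :: "'a \<Rightarrow> real"
    using that cts_bounded[OF X that] by (simp add: bcontfun_def cts_def)
  have app: "apply_bcontfun (Bcontfun g) = g" if "g \<in> cts" for g :: "'a \<Rightarrow> real"
    by (rule Bcontfun_inverse[OF bc[OF that]])
  have H_add: "H (\<lambda>x. g x + h x) = H g + H h" if "g \<in> cts" "h \<in> cts" for g h
  proof -
    have "Bcontfun (\<lambda>x. g x + h x) = Bcontfun g + Bcontfun h"
      using that by (intro bcontfun_eqI) (simp add: app plus_bcontfun.rep_eq cts_real_intros)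
    then show ?thesis by (simp add: H_def linear_add[OF G(1)])
  qed
  have H_scale: "H (\<lambda>x. a * g x) = a * H g" if "g \<in> cts" for a g
  proof -
    have "Bcontfun (\<lambda>x. a * g x) = a *\<^sub>R Bcontfun g"
      using that by (intro bcontfun_eqI) (simp add: app scaleR_bcontfun.rep_eq cts_real_intros)
    then show ?thesis by (simp add: H_def linear_scale[OF G(1)])
  qed
  have H_le: "H g \<le> re (F s)" if "g \<in> cts" "s \<in> S" "\<And>z. g z \<le> re (s z)" for g s
    unfolding H_def using order_trans[OF G(2) U_le] that by (simp add: app)
  have "0 \<le> H g" if "g \<in> cts" "\<forall>x. 0 \<le> g x" for g
    using H_le[of "\<lambda>x. (- 1) * g x" "\<lambda>x. of_real 0"] H_scale[OF that(1), of "- 1"] that const[of 0]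
    by (auto simp: re_0)
  then have "positive_functional H"
    using H_add H_scale by (simp add: positive_functional_def)
  moreover have "H (\<lambda>x. re (s x)) = re (F s)" if s: "s \<in> S" for s
  proof (rule antisym)
    have c: "(\<lambda>x. re (s x)) \<in> cts" using S(2) s cts_re by blast
    show "H (\<lambda>x. re (s x)) \<le> re (F s)" by (rule H_le[OF c s order_refl])
    have "H (\<lambda>x. (- 1) * re (s x)) \<le> re (F (\<lambda>x. of_real (- 1) * s x))"
      using c by (intro H_le lin_subspace_scale[OF S(1)] s) (auto simp: re_minus)
    then show "re (F s) \<le> H (\<lambda>x. re (s x))"
      unfolding H_scale[OF c] F_scale[OF s] by simp
  qed
  moreover have "\<exists>s\<in>S. (\<forall>z. f z \<le> re (s z)) \<and> re (F s) < H f + e" if "e > 0" for e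
    using U_less[of "Bcontfun f" "H f + e"] that by (simp add: H_def G(3) app[OF f])
  ultimately show thesis by (rule that)
qed

text \<open>Splitting the extension \<open>H\<close> as \<open>H(h \<cdot>) + H((1 - h) \<cdot>)\<close> with \<open>0 < h < 1\<close> writes \<open>F\<close> as a
  convex combination of two functionals in the unit ball, and \<open>h\<close> may itself be an affine
  function of \<open>re s\<close>.\<close>

lemma extreme_extension_square:
  fixes S :: "('a::topological_space \<Rightarrow> 'k) set"
  assumes X: "compact (UNIV :: 'a set)" and S: "lin_subspace S" "S \<subseteq> cts"
    and ext: "extreme_dual S F" and H: "positive_functional H" and H1: "H (\<lambda>x. 1) = 1"
    and HF: "\<And>s. s \<in> S \<Longrightarrow> H (\<lambda>x. re (s x)) = re (F s)" and s: "s \<in> S"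
  shows "H (\<lambda>x. re (s x) * re (s x)) = re (F s) * re (F s)"
proof -
  note c = cts_real_intros
  have cr: "(\<lambda>x. re (u x)) \<in> cts" if "u \<in> S" for u using that S(2) cts_re by blast
  \<comment> \<open>In measure terms, this is integration against the density \<open>h\<close>
    renormalized by its mass, which keeps the norm at most 1.\<close>
  have ball: "(\<lambda>u. H (\<lambda>x. h x * re (u x)) / H h) \<in> real_dual_ball S"
    if h: "h \<in> cts" "\<And>x. 0 \<le> h x" "0 < H h" for h
    unfolding real_dual_ball_def
  proof (intro CollectI conjI ballI allI)
    fix u u' assume u: "u \<in> S" "u' \<in> S"
    have "H (\<lambda>x. h x * re ((u + u') x)) = H (\<lambda>x. h x * re (u x) + h x * re (u' x))"
      by (simp add: re_add distrib_left)
    also have "\<dots> = H (\<lambda>x. h x * re (u x)) + H (\<lambda>x. h x * re (u' x))"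
      by (intro pf_add[OF H] c h cr u)
    finally show "H (\<lambda>x. h x * re ((u + u') x)) / H h
        = H (\<lambda>x. h x * re (u x)) / H h + H (\<lambda>x. h x * re (u' x)) / H h"
      by (simp add: add_divide_distrib)
  next
    fix a u assume u: "u \<in> S"
    have "H (\<lambda>x. h x * re (of_real a * u x)) = H (\<lambda>x. a * (h x * re (u x)))"
      by (simp add: re_scale mult_ac)
    also have "\<dots> = a * H (\<lambda>x. h x * re (u x))"
      by (intro pf_scale[OF H] c h cr u)
    finally show "H (\<lambda>x. h x * re (of_real a * u x)) / H h = a * (H (\<lambda>x. h x * re (u x)) / H h)"
      by simp
  next
    fix u assume u: "u \<in> S"
    have "h x * re (u x) \<le> supnorm u * h x" for x
    proof -
      have "re (u x) \<le> supnorm u"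
        using abs_re_le[of "u x"] norm_le_supnorm[OF X, of u x] u S(2) by auto
      then show ?thesis using h(2)[of x] by (subst mult.commute) (rule mult_right_mono)
    qed
    then have "H (\<lambda>x. h x * re (u x)) \<le> H (\<lambda>x. supnorm u * h x)"
      by (intro pf_mono[OF H] c h cr u)
    also have "\<dots> = supnorm u * H h" by (rule pf_scale[OF H h(1)])
    finally show "H (\<lambda>x. h x * re (u x)) / H h \<le> supnorm u"
      using h(3) by (simp add: field_simps)
  qed
  define v where "v x = re (s x)" for x
  have v: "v \<in> cts" using cr[OF s] by (simp add: v_def[abs_def])
  \<comment> \<open>The added 1 keeps \<open>B\<close> positive even for
    \<open>s = 0\<close>.\<close>
  define B where "B = supnorm s + 1"
  have sc: "s \<in> cts" using s S(2) by blast
  have B: "B > 0" using supnorm_nonneg[OF X sc] by (simp add: B_def)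
  have vB: "\<bar>v x\<bar> \<le> B" for x
    using abs_re_le[of "s x"] norm_le_supnorm[OF X sc, of x] by (simp add: v_def B_def)
  \<comment> \<open>Since \<open>\<bar>v x\<bar> \<le> B\<close>, the perturbation of 1/2 is at most
    1/4, so \<open>h\<close> and \<open>1 - h\<close> both take values in [1/4, 3/4] and have
    positive mass.\<close>
  define h where "h x = 1 / 2 + 1 / (4 * B) * v x" for x
  have h: "h \<in> cts" unfolding h_def[abs_def] by (intro c v)
  have h_bound: "1 / 4 \<le> h x" "h x \<le> 3 / 4" for x
    using vB[of x] B by (auto simp: h_def abs_le_iff field_simps)
  have "H (\<lambda>x. 1 / 4) \<le> H h" "H h \<le> H (\<lambda>x. 3 / 4)"
    using h_bound by (intro pf_mono[OF H] c h; simp)+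
  then have Hh: "0 < H h" "H h < 1"
    using pf_const[OF H, of "1/4"] pf_const[OF H, of "3/4"] H1 by simp_all
  define h' where "h' x = 1 - h x" for x
  have h': "h' \<in> cts" unfolding h'_def[abs_def] by (intro c h)
  have Hh': "H h' = 1 - H h"
    using pf_diff[OF H c(1) h, of 1] H1 by (simp add: h'_def[abs_def])
  have split: "re (F u) = H h * (H (\<lambda>x. h x * re (u x)) / H h)
      + (1 - H h) * (H (\<lambda>x. h' x * re (u x)) / H h')" if u: "u \<in> S" for u
  proof -
    have "H (\<lambda>x. h x * re (u x)) + H (\<lambda>x. h' x * re (u x))
        = H (\<lambda>x. h x * re (u x) + h' x * re (u x))"
      by (intro pf_add[OF H, symmetric] c h h' cr u)
    also have "(\<lambda>x. h x * re (u x) + h' x * re (u x)) = (\<lambda>x. re (u x))"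
      by (simp add: h'_def left_diff_distrib)
    finally show ?thesis using Hh HF[OF u] by (simp add: Hh')
  qed
  have "H (\<lambda>x. h x * re (s x)) / H h = H (\<lambda>x. h' x * re (s x)) / H h'"
  proof (rule extreme_dual_real[OF S(1) ext _ _ Hh split s])
    show "(\<lambda>u. H (\<lambda>x. h x * re (u x)) / H h) \<in> real_dual_ball S"
      using h_bound(1) Hh by (intro ball h) (auto intro: order_trans[of _ "1/4"])
    show "(\<lambda>u. H (\<lambda>x. h' x * re (u x)) / H h') \<in> real_dual_ball S"
    proof (rule ball[OF h'])
      show "0 \<le> h' x" for x using h_bound(2)[of x] by (simp add: h'_def)
      show "0 < H h'" using Hh Hh' by simp
    qed
  qed
  with split[OF s] have "H (\<lambda>x. h x * re (s x)) / H h = re (F s)"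
    by (simp only: distrib_right[symmetric]) simp
  then have "H (\<lambda>x. h x * v x) = H h * H v"
    using Hh HF[OF s] by (simp add: v_def[abs_def] field_simps)
  moreover have "H (\<lambda>x. h x * v x) = 1 / 2 * H v + 1 / (4 * B) * H (\<lambda>x. v x * v x)"
  proof -
    have "H (\<lambda>x. h x * v x) = H (\<lambda>x. 1 / 2 * v x + 1 / (4 * B) * (v x * v x))"
      by (simp add: h_def algebra_simps)
    also have "\<dots> = H (\<lambda>x. 1 / 2 * v x) + H (\<lambda>x. 1 / (4 * B) * (v x * v x))"
      by (intro pf_add[OF H] c v)
    also have "\<dots> = 1 / 2 * H v + 1 / (4 * B) * H (\<lambda>x. v x * v x)"
      using v by (simp only: pf_scale[OF H] c)
    finally show ?thesis .
  qed
  moreover have "H h = 1 / 2 + 1 / (4 * B) * H v"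
  proof -
    have "H h = H (\<lambda>x. 1 / 2) + H (\<lambda>x. 1 / (4 * B) * v x)"
      unfolding h_def[abs_def] by (intro pf_add[OF H] c v)
    then show ?thesis using pf_const[OF H, of "1 / 2"] H1 by (simp only: pf_scale[OF H v] mult_1_right)
  qed
  \<comment> \<open>\<open>H (h v) = H h * H v\<close> is expanded on both sides; the terms
    \<open>1 / 2 * H v\<close> cancel and the quadratic terms remain.\<close>
  ultimately have "1 / (4 * B) * H (\<lambda>x. v x * v x) = 1 / (4 * B) * (H v * H v)"
    by (simp add: algebra_simps)
  then have "H (\<lambda>x. v x * v x) = H v * H v" using B by simp
  then show ?thesis using HF[OF s] by (simp add: v_def[abs_def])
qed

text \<open>\<open>D s\<close> is a square with \<open>H (D s) = 0\<close>. If these squares had no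
  common zero, null functions would cover the whole compact space and \<open>H\<close> would vanish
  on 1. At a common zero \<open>x\<close>, separation by \<open>S\<close> makes every other point
  null.\<close>

lemma extreme_extension_evaluation:
  fixes S :: "('a::topological_space \<Rightarrow> 'k) set"
  assumes X: "compact (UNIV :: 'a set)" and S: "function_space S"
    and ext: "extreme_dual S F" and H: "positive_functional H" and H1: "H (\<lambda>x. 1) = 1"
    and HF: "\<And>s. s \<in> S \<Longrightarrow> H (\<lambda>x. re (s x)) = re (F s)"
  obtains x where "\<And>s. s \<in> S \<Longrightarrow> F s = s x" "\<And>f. f \<in> cts \<Longrightarrow> H f = f x"
proof -
  have S': "lin_subspace S" "S \<subseteq> cts"
    and sep: "\<And>x z. x \<noteq> z \<Longrightarrow> \<exists>s\<in>S. s x \<noteq> s z"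
    using S by (auto simp: function_space_def)
  note c = cts_real_intros
  define D where "D s x = (re (s x) - re (F s)) * (re (s x) - re (F s))" for s x
  have D: "D s \<in> cts" "\<And>x. 0 \<le> D s x" "H (D s) = 0" if s: "s \<in> S" for s
  proof -
    define v where "v x = re (s x)" for x
    define a where "a = re (F s)"
    have v: "v \<in> cts" using s S'(2) cts_re by (auto simp: v_def[abs_def])
    have Hv: "H v = a" using HF[OF s] by (simp add: v_def[abs_def] a_def)
    have Dv: "D s = (\<lambda>x. v x * v x + (- 2 * a * v x + a * a))"
      by (simp add: fun_eq_iff D_def v_def a_def algebra_simps)
    show "D s \<in> cts" unfolding Dv by (intro c v)
    show "0 \<le> D s x" for x by (simp add: D_def)
    have "H (D s) = H (\<lambda>x. v x * v x) + H (\<lambda>x. - 2 * a * v x + a * a)"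
      unfolding Dv by (intro pf_add[OF H] c v)
    also have "H (\<lambda>x. v x * v x) = a * a"
      using extreme_extension_square[OF X S' ext H H1 HF s] by (simp add: v_def a_def)
    also have "H (\<lambda>x. - 2 * a * v x + a * a) = H (\<lambda>x. - 2 * a * v x) + H (\<lambda>x. a * a)"
      by (intro pf_add[OF H] c v)
    also have "H (\<lambda>x. - 2 * a * v x) = - 2 * a * a"
      using pf_scale[OF H v, of "- 2 * a"] Hv by simp
    also have "H (\<lambda>x. a * a) = a * a"
      using pf_const[OF H, of "a * a"] H1 by simp
    finally show "H (D s) = 0" by simp
  qed
  have "\<exists>x. \<forall>s\<in>S. re (s x) = re (F s)"
  proof (rule ccontr)
    assume no: "\<not> ?thesis"
    have null: "\<exists>d\<in>cts. (\<forall>z. 0 \<le> d z) \<and> H d = 0 \<and> 0 < d x" for x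
    proof -
      obtain s where s: "s \<in> S" "re (s x) \<noteq> re (F s)" using no by blast
      then have "0 < D s x" by (auto simp: D_def zero_less_mult_iff)
      with D[OF s(1)] show ?thesis by blast
    qed
    obtain d where d: "d \<in> cts" "\<And>z. z \<in> UNIV \<Longrightarrow> 1 \<le> d z" "H d = 0"
      using pf_null_cover[OF H X closed_UNIV null] by metis
    have "H (\<lambda>x. 1) \<le> H d" using d by (intro pf_mono[OF H] c) auto
    with d(3) H1 show False by simp
  qed
  then obtain x where x: "\<And>s. s \<in> S \<Longrightarrow> re (s x) = re (F s)" by blast
  have F: "F \<in> dual_unit_ball S" using ext by (simp add: extreme_dual_def)
  have "F s = s x" if s: "s \<in> S" for s
    using F x[OF s] x[OF lin_subspace_scale[OF S'(1) s, of c]] s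
    unfolding eq_iff_re[of "F s"] by (simp add: dual_unit_ball_def)
  moreover have "H f = f x" if f: "f \<in> cts" for f
  proof (rule pf_evaluation[OF H X H1 _ f])
    fix z assume "z \<noteq> x"
    then obtain s where s: "s \<in> S" "s z \<noteq> s x" using sep by blast
    \<comment> \<open>\<open>S\<close> separates values but \<open>D\<close> sees only real parts,
      so the separating function is rotated until the real parts differ.\<close>
    obtain l where l: "re (l * (s z - s x)) = norm (s z - s x)" by (rule rotation)
    define u where "u x = l * s x" for x
    have u: "u \<in> S" unfolding u_def by (rule lin_subspace_scale[OF S'(1) s(1)])
    have "re (u z) - re (F u) = norm (s z - s x)"
      using x[OF u] l by (simp add: u_def right_diff_distrib re_diff)
    then have "0 < D u z" using s(2) by (simp add: D_def)
    with D[OF u] show "\<exists>d\<in>cts. (\<forall>z. 0 \<le> d z) \<and> H d = 0 \<and> 0 < d z" by blast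
  qed
  ultimately show thesis by (rule that)
qed

text \<open>Each \<open>f\<close> comes with its own extension and hence its own point. All these
  points represent the same \<open>F\<close> on \<open>S\<close>, and \<open>S\<close> separates
  points, so a single \<open>x\<close> serves every \<open>f\<close>.\<close>

theorem extreme_state_envelope:
  fixes S :: "('a::topological_space \<Rightarrow> 'k) set"
  assumes X: "compact (UNIV :: 'a set)" and S: "function_space S"
    and ext: "extreme_dual S F" and F1: "F (\<lambda>x. 1) = 1"
    and pos: "\<And>s. s \<in> S \<Longrightarrow> (\<And>z. 0 \<le> re (s z)) \<Longrightarrow> 0 \<le> re (F s)"
  obtains x where "\<And>s. s \<in> S \<Longrightarrow> F s = s x"
    "\<And>f e. f \<in> cts \<Longrightarrow> e > 0 \<Longrightarrow> \<exists>s\<in>S. (\<forall>z. f z \<le> re (s z)) \<and> re (s x) < f x + e"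
proof -
  have S': "lin_subspace S" "S \<subseteq> cts" "(\<lambda>x. 1) \<in> S"
    and sep: "\<And>x z. x \<noteq> z \<Longrightarrow> \<exists>s\<in>S. s x \<noteq> s z"
    using S by (auto simp: function_space_def)
  have F: "F \<in> dual_unit_ball S" using ext by (simp add: extreme_dual_def)
  have ex: "\<exists>x. (\<forall>s\<in>S. F s = s x) \<and>
      (\<forall>e>0. \<exists>s\<in>S. (\<forall>z. f z \<le> re (s z)) \<and> re (F s) < f x + e)" if f: "f \<in> cts" for f
  proof -
    obtain H where H: "positive_functional H" "\<And>s. s \<in> S \<Longrightarrow> H (\<lambda>x. re (s x)) = re (F s)"
      "\<And>e. e > 0 \<Longrightarrow> \<exists>s\<in>S. (\<forall>z. f z \<le> re (s z)) \<and> re (F s) < H f + e"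
      using positive_extension[OF X S' F F1 pos f] by blast
    have "H (\<lambda>x. 1) = 1" using H(2)[OF S'(3)] F1 by (simp add: re_one)
    then obtain x where "\<And>s. s \<in> S \<Longrightarrow> F s = s x" "\<And>f. f \<in> cts \<Longrightarrow> H f = f x"
      using extreme_extension_evaluation[OF X S ext H(1) _ H(2)] by blast
    then show ?thesis using H(3) f by (intro exI[of _ x]) simp
  qed
  obtain x where x: "\<And>s. s \<in> S \<Longrightarrow> F s = s x" using ex[of "\<lambda>x. 0"] by blast
  have "\<exists>s\<in>S. (\<forall>z. f z \<le> re (s z)) \<and> re (s x) < f x + e" if f: "f \<in> cts" and e: "e > 0" for f e
  proof -
    obtain y where y: "\<And>s. s \<in> S \<Longrightarrow> F s = s y"
      "\<exists>s\<in>S. (\<forall>z. f z \<le> re (s z)) \<and> re (F s) < f y + e"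
      using ex[OF f] e by blast
    have "y = x" using sep[of x y] x y(1) by metis
    with y x show ?thesis by auto
  qed
  with x show thesis by (rule that)
qed

end

section \<open>Isometries and positive operators\<close>

lemma lin_subspace_cts: "lin_subspace (cts :: ('z::topological_space \<Rightarrow> 'k::real_normed_field) set)"
  by (auto simp: lin_subspace_def cts_def plus_fun_def intro!: continuous_intros)

lemma lin_subspace_kspan: "lin_subspace (kspan A)"
  by (auto simp: lin_subspace_def kspan_def)

lemma subset_kspan: "A \<subseteq> kspan A"
  by (auto simp: kspan_def)

lemma kspan_subset_cts: "A \<subseteq> cts \<Longrightarrow> kspan A \<subseteq> cts"
  using lin_subspace_cts by (auto simp: kspan_def)

text \<open>A linear isometry is injective, and composing with its inverse carries the dual ball of
  \<open>S\<close> into that of the image, so a convex decomposition on \<open>S\<close> becomes one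
  on the image.\<close>

lemma extreme_dual_isometry:
  fixes S :: "('a::topological_space \<Rightarrow> 'k::real_normed_field) set"
  assumes X: "compact (UNIV :: 'a set)" and S: "lin_subspace S" "S \<subseteq> cts"
    and add: "\<And>f g. f \<in> S \<Longrightarrow> g \<in> S \<Longrightarrow> L (f + g) = L f + L g"
    and scale: "\<And>k f. f \<in> S \<Longrightarrow> L (\<lambda>x. k * f x) = (\<lambda>y. k * L f y)"
    and norm: "\<And>f. f \<in> S \<Longrightarrow> supnorm (L f) = supnorm f"
    and ext: "extreme_dual (L ` S) F"
  shows "extreme_dual S (\<lambda>f. F (L f))"
proof -
  have "inj_on L S"
  proof (rule inj_onI)
    fix f g assume fg: "f \<in> S" "g \<in> S" "L f = L g"
    define d where "d = f + (\<lambda>x. (- 1) * g x)"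
    have d: "d \<in> S" unfolding d_def by (intro lin_subspace_add lin_subspace_scale S fg)
    have "L d = L f + (\<lambda>y. (- 1) * L g y)"
      unfolding d_def using fg(1,2) by (simp only: add scale lin_subspace_scale[OF S(1)])
    then have "L d = (\<lambda>y. 0)" using fg(3) by (simp add: fun_eq_iff)
    then have "supnorm d = 0" using norm[OF d] by (simp add: supnorm_def)
    moreover have "norm (d x) \<le> supnorm d" for x
      using d S(2) by (intro norm_le_supnorm[OF X]) auto
    ultimately have "d x = 0" for x by (metis norm_le_zero_iff)
    then show "f = g" by (simp add: d_def fun_eq_iff)
  qed
  then have inv: "inv_into S L (L f) = f" if "f \<in> S" for f
    using that by simp
  have ball: "\<psi> \<circ> inv_into S L \<in> dual_unit_ball (L ` S)" if \<psi>: "\<psi> \<in> dual_unit_ball S" for \<psi>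
  proof -
    have "\<psi> (inv_into S L (L f + L g)) = \<psi> f + \<psi> g" if "f \<in> S" "g \<in> S" for f g
    proof -
      have "inv_into S L (L f + L g) = f + g"
        using that inv[of "f + g"] by (simp add: add lin_subspace_add[OF S(1)])
      then show ?thesis using \<psi> that by (simp add: dual_unit_ball_def)
    qed
    moreover have "\<psi> (inv_into S L (\<lambda>y. k * L f y)) = k * \<psi> f" if f: "f \<in> S" for k f
      using \<psi> f inv[OF lin_subspace_scale[OF S(1) f, of k]] scale[OF f, of k]
      by (simp add: dual_unit_ball_def)
    moreover have "norm (\<psi> f) \<le> supnorm (L f)" if "f \<in> S" for f
      using \<psi> that by (simp add: norm dual_unit_ball_def)
    ultimately show ?thesis by (auto simp: dual_unit_ball_def inv)
  qed
  have F: "F \<in> dual_unit_ball (L ` S)" using ext by (simp add: extreme_dual_def)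
  have "F (L (f + g)) = F (L f) + F (L g)" if "f \<in> S" "g \<in> S" for f g
    using F that by (simp add: add dual_unit_ball_def)
  moreover have "F (L (\<lambda>x. k * f x)) = k * F (L f)" if "f \<in> S" for k f
    using F that by (simp add: scale dual_unit_ball_def)
  moreover have "Real_Vector_Spaces.norm (F (L f)) \<le> supnorm f" if "f \<in> S" for f
    using F that norm[OF that] by (auto simp: dual_unit_ball_def)
  ultimately have "(\<lambda>f. F (L f)) \<in> dual_unit_ball S"
    by (simp add: dual_unit_ball_def)
  moreover have "\<psi>1 f = \<psi>2 f"
    if \<psi>: "\<psi>1 \<in> dual_unit_ball S" "\<psi>2 \<in> dual_unit_ball S" and t: "0 < t" "t < 1"
      and comb: "\<And>f. f \<in> S \<Longrightarrow> F (L f) = t *\<^sub>R \<psi>1 f + (1 - t) *\<^sub>R \<psi>2 f" and f: "f \<in> S"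
    for \<psi>1 \<psi>2 f and t :: real
  proof -
    have "\<forall>g\<in>L ` S. F g = t *\<^sub>R (\<psi>1 \<circ> inv_into S L) g + (1 - t) *\<^sub>R (\<psi>2 \<circ> inv_into S L) g"
      using comb inv by simp
    then have "\<forall>g\<in>L ` S. (\<psi>1 \<circ> inv_into S L) g = (\<psi>2 \<circ> inv_into S L) g"
      using ext ball[OF \<psi>(1)] ball[OF \<psi>(2)] t unfolding extreme_dual_def by blast
    then show ?thesis using f inv by simp
  qed
  ultimately show ?thesis unfolding extreme_dual_def by blast
qed

section \<open>Normalization, Lipschitz functionals and positivity of real parts\<close>

context scalars
begin

text \<open>Positivity makes \<open>r = F 1\<close> real and bounds \<open>re F\<close> by
  \<open>r\<close> times the norm. The slack \<open>1 - r\<close> leaves room for adding plus or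
  minus \<open>1 - r\<close> times a point evaluation without leaving the dual ball; extremality
  forces the two perturbations to agree at 1, so \<open>r = 1\<close>.\<close>

lemma extreme_positive_normalized:
  fixes S :: "('a::topological_space \<Rightarrow> 'k) set"
  assumes X: "compact (UNIV :: 'a set)" and S: "lin_subspace S" "S \<subseteq> cts" "(\<lambda>x. 1) \<in> S"
    and ext: "extreme_dual S F"
    and pos: "\<And>s. s \<in> S \<Longrightarrow> (\<And>z. 0 \<le> re (s z)) \<Longrightarrow> 0 \<le> re (F s)"
  shows "F (\<lambda>x. 1) = 1"
proof -
  have F: "F \<in> dual_unit_ball S" using ext by (simp add: extreme_dual_def)
  have F_add: "F (s + s') = F s + F s'" if "s \<in> S" "s' \<in> S" for s s'
    using F that by (simp add: dual_unit_ball_def)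
  have F_scale: "F (\<lambda>x. k * s x) = k * F s" if "s \<in> S" for k s
    using F that by (simp add: dual_unit_ball_def)
  note const = lin_subspace_scale[OF S(1,3)]
  have F_const: "F (\<lambda>x. k) = k * F (\<lambda>x. 1)" for k
    using F_scale[OF S(3), of k] by simp
  define r where "r = re (F (\<lambda>x. 1))"
  \<comment> \<open>The constants \<open>c\<close> and \<open>- c\<close> have real part 0, so
    positivity applies to both and kills the second coordinate of \<open>F 1\<close>.\<close>
  have c: "0 \<le> re (k * c * F (\<lambda>x. 1))" if "k = 1 \<or> k = - 1" for k
    using pos[OF const, of "k * c"] re_c[of 1] that
    by (auto simp: F_const[of "k * c"] F_const[of "- c"] F_const[of c] re_minus)
  have F1: "F (\<lambda>x. 1) = of_real r"
    unfolding eq_iff_re[of "F (\<lambda>x. 1)"] using c[of 1] c[of "- 1"]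
    by (simp add: r_def re_of_real re_c re_minus)
  have "norm (F (\<lambda>x. 1)) \<le> supnorm (\<lambda>x::'a. 1::'k)"
    using F S(3) by (simp add: dual_unit_ball_def)
  also have "\<dots> \<le> 1" by (rule supnorm_le) simp
  finally have r: "r \<le> 1" by (simp add: F1)
  have ub: "re (F s) \<le> r * supnorm s" if s: "s \<in> S" for s
  proof -
    have "s \<in> cts" using s S(2) by blast
    then have "re (s z) \<le> supnorm s" for z
      using abs_re_le[of "s z"] norm_le_supnorm[OF X, of s z] by simp
    then have "0 \<le> re (F ((\<lambda>x. of_real (supnorm s) * 1) + (\<lambda>x. (- 1) * s x)))"
      by (intro pos lin_subspace_add const lin_subspace_scale S(1) s) (simp add: re_diff re_of_real)
    also have "\<dots> = re (of_real (supnorm s) * F (\<lambda>x. 1)) - re (F s)"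
      using F_add[OF const[of "of_real (supnorm s)"] lin_subspace_scale[OF S(1) s, of "- 1"]]
        F_scale[OF s, of "- 1"]
        F_scale[OF S(3), of "of_real (supnorm s)"]
      by (simp add: re_diff)
    finally show ?thesis by (simp only: re_scale r_def) (simp add: mult.commute)
  qed
  \<comment> \<open>Any point of the space will do.\<close>
  define x0 :: 'a where "x0 = undefined"
  have ball: "(\<lambda>s. re (F s) + a * re (s x0)) \<in> real_dual_ball S" if "\<bar>a\<bar> \<le> 1 - r" for a
    unfolding real_dual_ball_def
  proof (intro CollectI conjI ballI allI)
    fix s assume s: "s \<in> S"
    have "a * re (s x0) \<le> (1 - r) * supnorm s"
    proof -
      have "s \<in> cts" using s S(2) by blast
      then have "\<bar>re (s x0)\<bar> \<le> supnorm s"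
        using abs_re_le[of "s x0"] norm_le_supnorm[OF X, of s x0] by simp
      with that have "\<bar>a\<bar> * \<bar>re (s x0)\<bar> \<le> (1 - r) * supnorm s"
        by (intro mult_mono) auto
      then show ?thesis by (simp add: abs_mult[symmetric])
    qed
    with ub[OF s] show "re (F s) + a * re (s x0) \<le> supnorm s"
      by (simp add: algebra_simps)
  qed (simp_all add: F_add F_scale re_add re_scale distrib_left add_ac mult.left_commute)
  have "re (F (\<lambda>x. 1)) + (1 - r) * re 1 = re (F (\<lambda>x. 1)) + (- (1 - r)) * re 1"
    using r by (intro extreme_dual_real[OF S(1) ext ball[of "1 - r"] ball[of "- (1 - r)"],
      of "1/2" "\<lambda>x. 1"] S(3)) (simp_all add: field_simps)
  then show ?thesis by (simp add: F1 re_one)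
qed

lemma norm_of_real_diff_sq: "(norm (of_real r - g))\<^sup>2 = r\<^sup>2 - 2 * r * re g + (norm g)\<^sup>2"
  unfolding norm_sq by (simp add: right_diff_distrib re_diff re_of_real re_c power2_eq_square algebra_simps)

text \<open>Comparing \<open>f\<close> with \<open>s - r\<close> for a large constant \<open>r\<close> turns the Lipschitz bound into a
  one-sided estimate, so neither linearity nor the Mazur-Ulam theorem is needed.\<close>

lemma lipschitz_re_le:
  fixes M :: "('a::topological_space \<Rightarrow> 'k) set"
  assumes X: "compact (UNIV :: 'a set)" and M: "M \<subseteq> cts"
    and S: "lin_subspace S" "(\<lambda>x. 1) \<in> S" "S \<subseteq> M"
    and lip: "\<And>f g. f \<in> M \<Longrightarrow> g \<in> M \<Longrightarrow> norm (\<Phi> f - \<Phi> g) \<le> supnorm (f - g)"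
    and eval: "\<And>s. s \<in> S \<Longrightarrow> \<Phi> s = s x"
    and env: "\<And>f e. f \<in> cts \<Longrightarrow> e > 0 \<Longrightarrow> \<exists>s\<in>S. (\<forall>z. f z \<le> re (s z)) \<and> re (s x) < f x + e"
    and f: "f \<in> M"
  shows "re (\<Phi> f) \<le> re (f x)"
proof (rule field_le_epsilon)
  fix e' :: real assume "e' > 0"
  define e where "e = e' / 2"
  have e: "e > 0" using \<open>e' > 0\<close> by (simp add: e_def)
  obtain s where s: "s \<in> S" "\<And>z. re (f z) \<le> re (s z)" "re (s x) < re (f x) + e"
    using env[OF cts_re e, of f] f M by blast
  define B where "B = supnorm s + supnorm f"
  have "s \<in> cts" "f \<in> cts" using s(1) f S(3) M by auto
  then have B: "norm (s z - f z) \<le> B" for z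
    using norm_triangle_ineq4[of "s z" "f z"] norm_le_supnorm[OF X, of s z]
      norm_le_supnorm[OF X, of f z] by (simp add: B_def)
  \<comment> \<open>Chosen so that \<open>2 * r * e = B\<^sup>2\<close>, whence
    \<open>r\<^sup>2 + B\<^sup>2 \<le> (r + e)\<^sup>2\<close>: moving \<open>s\<close> by the large
    constant \<open>r\<close> costs only \<open>e\<close> beyond \<open>r\<close>.\<close>
  define r where "r = B\<^sup>2 / (2 * e)"
  have r: "r \<ge> 0" using e by (simp add: r_def)
  define s' where "s' = s - (\<lambda>x. of_real r * 1)"
  have s': "s' \<in> S"
    unfolding s'_def by (intro lin_subspace_diff lin_subspace_scale S s(1))
  have "supnorm (f - s') \<le> r + e"
  proof (rule supnorm_le)
    fix z
    have "(norm ((f - s') z))\<^sup>2 = (norm (of_real r - (s z - f z)))\<^sup>2"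
      by (simp add: s'_def algebra_simps)
    also have "\<dots> \<le> r\<^sup>2 + B\<^sup>2"
    proof -
      have "0 \<le> r * re (s z - f z)" using r s(2)[of z] by (simp add: re_diff)
      moreover have "(norm (s z - f z))\<^sup>2 \<le> B\<^sup>2" using B by (intro power_mono) auto
      ultimately show ?thesis by (simp add: norm_of_real_diff_sq)
    qed
    also have "\<dots> \<le> (r + e)\<^sup>2"
      using e unfolding power2_sum r_def by (simp add: field_simps)
    finally show "norm ((f - s') z) \<le> r + e"
      by (rule power2_le_imp_le) (use r e in simp)
  qed
  moreover have "s' \<in> M" using s' S(3) by blast
  ultimately have "norm (\<Phi> f - \<Phi> s') \<le> r + e"
    using lip[OF f, of s'] by simp
  then have "re (\<Phi> f) - re (\<Phi> s') \<le> r + e"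
    using abs_re_le[of "\<Phi> f - \<Phi> s'"] by (simp add: re_diff)
  moreover have "re (\<Phi> s') = re (s x) - r"
    unfolding eval[OF s'] by (simp add: s'_def re_diff re_of_real)
  ultimately show "re (\<Phi> f) \<le> re (f x) + e'"
    using s(3) by (simp add: e_def)
qed

text \<open>Conjugating \<Phi> by a unit scalar, inside and outside, preserves the Lipschitz bound
  and the values on \<open>S\<close>. The one-sided estimate for the conjugate, with
  \<open>l\<close> adapted to \<open>\<Phi> f - f x\<close>, bounds the norm of this difference by
  0.\<close>

lemma lipschitz_evaluation:
  fixes M :: "('a::topological_space \<Rightarrow> 'k) set"
  assumes X: "compact (UNIV :: 'a set)" and M: "lin_subspace M" "M \<subseteq> cts"
    and S: "lin_subspace S" "(\<lambda>x. 1) \<in> S" "S \<subseteq> M"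
    and lip: "\<And>f g. f \<in> M \<Longrightarrow> g \<in> M \<Longrightarrow> norm (\<Phi> f - \<Phi> g) \<le> supnorm (f - g)"
    and eval: "\<And>s. s \<in> S \<Longrightarrow> \<Phi> s = s x"
    and env: "\<And>f e. f \<in> cts \<Longrightarrow> e > 0 \<Longrightarrow> \<exists>s\<in>S. (\<forall>z. f z \<le> re (s z)) \<and> re (s x) < f x + e"
    and f: "f \<in> M"
  shows "\<Phi> f = f x"
proof -
  obtain l where l: "norm l = 1" "re (l * (\<Phi> f - f x)) = norm (\<Phi> f - f x)" by (rule rotation)
  then have l0: "l \<noteq> 0" by auto
  define \<Phi>' where "\<Phi>' g = l * \<Phi> (\<lambda>x. inverse l * g x)" for g
  have "re (\<Phi>' (\<lambda>x. l * f x)) \<le> re (l * f x)"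
  proof (rule lipschitz_re_le[OF X M(2) S _ _ env])
    fix g h assume gh: "g \<in> M" "h \<in> M"
    have "norm (\<Phi>' g - \<Phi>' h) = norm (\<Phi> (\<lambda>x. inverse l * g x) - \<Phi> (\<lambda>x. inverse l * h x))"
      by (simp add: \<Phi>'_def right_diff_distrib[symmetric] norm_mult l(1))
    also have "\<dots> \<le> supnorm ((\<lambda>x. inverse l * g x) - (\<lambda>x. inverse l * h x))"
      by (intro lip lin_subspace_scale M(1) gh)
    also have "(\<lambda>x. inverse l * g x) - (\<lambda>x. inverse l * h x) = (\<lambda>x. inverse l * (g - h) x)"
      by (simp add: fun_eq_iff right_diff_distrib)
    also have "supnorm \<dots> = supnorm (g - h)"
      by (rule supnorm_rotate) (simp add: norm_inverse l(1))
    finally show "norm (\<Phi>' g - \<Phi>' h) \<le> supnorm (g - h)" .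
  next
    fix s assume "s \<in> S"
    then show "\<Phi>' s = s x"
      using eval[OF lin_subspace_scale[OF S(1), of s "inverse l"]] l0 by (simp add: \<Phi>'_def)
  qed (auto intro: lin_subspace_scale[OF M(1)] f)
  moreover have "\<Phi>' (\<lambda>x. l * f x) = l * \<Phi> f"
    using l0 by (simp add: \<Phi>'_def mult.assoc[symmetric])
  ultimately have "norm (\<Phi> f - f x) \<le> 0"
    unfolding l(2)[symmetric] right_diff_distrib re_diff by simp
  then show ?thesis by simp
qed

text \<open>Self-conjugacy puts the coordinates \<open>p\<close> and \<open>q\<close> of
  \<open>f\<close> into \<open>M\<close>. The operator maps \<open>p \<ge> 0\<close> to a
  nonnegative function and \<open>q\<close> to a real one, since \<open>q\<close> is a nonnegative
  function minus a constant. So \<open>c q\<close> contributes nothing to the real part.\<close>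

lemma positive_on_re:
  fixes M :: "('a::topological_space \<Rightarrow> 'k) set"
  assumes X: "compact (UNIV :: 'a set)" and M: "lin_subspace M" "M \<subseteq> cts" "(\<lambda>x. 1) \<in> M"
    and sc: "self_conjugate cj M" and L: "linear_on M L" "positive_on M L"
    and f: "f \<in> M" "\<And>x. 0 \<le> re (f x)"
  shows "0 \<le> re (L f y)"
proof -
  have L_add: "L (g + h) = L g + L h" if "g \<in> M" "h \<in> M" for g h
    using L(1) that by (simp add: linear_on_def)
  have L_scale: "L (\<lambda>x. k * g x) = (\<lambda>y. k * L g y)" if "g \<in> M" for k g
    using L(1) that by (simp add: linear_on_def)
  have L_pos: "nonneg_scalar (L g y)" if "g \<in> M" "\<And>x. nonneg_scalar (g x)" for g
    using L(2) that by (simp add: positive_on_def)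
  have re_M: "(\<lambda>x. of_real (re (g x))) \<in> M" if g: "g \<in> M" for g
  proof -
    have "(\<lambda>x. of_real (1 / 2) * (g + (\<lambda>x. cj (g x))) x) \<in> M"
      using sc g by (intro lin_subspace_scale lin_subspace_add M(1)) (simp_all add: self_conjugate_def)
    also have "(\<lambda>x. of_real (1 / 2) * (g + (\<lambda>x. cj (g x))) x) = (\<lambda>x. of_real (re (g x)))"
      by (simp add: fun_eq_iff plus_cj)
    finally show ?thesis .
  qed
  define p :: "'a \<Rightarrow> 'k" where "p x = of_real (re (f x))" for x
  define q :: "'a \<Rightarrow> 'k" where "q x = of_real (re (- c * f x))" for x
  have p: "p \<in> M" using re_M[OF f(1)] by (simp add: p_def[abs_def])
  have q: "q \<in> M"
    using re_M[OF lin_subspace_scale[OF M(1) f(1), of "- c"]] by (simp add: q_def[abs_def])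
  have "f x = p x + c * q x" for x
    unfolding p_def q_def by (rule decomp)
  then have "f = p + (\<lambda>x. c * q x)" by (simp add: fun_eq_iff)
  then have "L f = L (p + (\<lambda>x. c * q x))" by simp
  also have "\<dots> = L p + (\<lambda>y. c * L q y)"
    using p q by (simp add: L_add L_scale lin_subspace_scale[OF M(1)])
  finally have Lf: "L f y = L p y + c * L q y" by simp
  have "nonneg_scalar (L p y)"
    using f(2) by (intro L_pos p) (auto simp: p_def nonneg_scalar_def)
  then have 1: "0 \<le> re (L p y)" by (auto simp: nonneg_scalar_def re_of_real)
  define B where "B = supnorm q"
  have "nonneg_scalar ((q + (\<lambda>x. of_real B * 1)) x)" for x
  proof -
    have "norm (q x) \<le> B" using norm_le_supnorm[OF X, of q x] q M(2) by (auto simp: B_def)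
    then have "0 \<le> re (- c * f x) + B" by (simp add: q_def abs_le_iff)
    then show ?thesis
      unfolding nonneg_scalar_def by (intro exI[of _ "re (- c * f x) + B"]) (simp add: q_def)
  qed
  then have "nonneg_scalar (L (q + (\<lambda>x. of_real B * 1)) y)"
    by (intro L_pos lin_subspace_add lin_subspace_scale M q)
  moreover have "nonneg_scalar (L (\<lambda>x. 1) y)"
    by (intro L_pos M) (auto simp: nonneg_scalar_def intro: exI[of _ "1::real"])
  ultimately obtain a b where ab: "L (q + (\<lambda>x. of_real B * 1)) y = of_real a" "L (\<lambda>x. 1) y = of_real b"
    by (auto simp: nonneg_scalar_def)
  have "L (q + (\<lambda>x. of_real B * 1)) y = L q y + of_real B * L (\<lambda>x. 1) y"
    unfolding L_add[OF q lin_subspace_scale[OF M(1,3)]] L_scale[OF M(3)] by simp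
  then have "L q y = of_real (a - B * b)"
    using ab by (simp add: eq_diff_eq)
  then have 2: "re (c * L q y) = 0" by (simp only: re_c)
  show ?thesis using 1 2 by (simp add: Lf re_add)
qed

end

section \<open>The Korovkin-type theorem\<close>

context scalars
begin

text \<open>The span enters only as a subspace \<open>N\<close> of continuous functions that
  contains every difference \<open>T n f - Tinf f\<close>.\<close>

theorem korovkin_isometry:
  fixes M S :: "('a::t2_space \<Rightarrow> 'k) set" and T :: "nat \<Rightarrow> ('a \<Rightarrow> 'k) \<Rightarrow> ('b::t2_space \<Rightarrow> 'k)"
  assumes X: "compact (UNIV :: 'a set)" and Y: "compact (UNIV :: 'b set)"
    and M: "lin_subspace M" "M \<subseteq> cts" "self_conjugate cj M"
    and S: "function_space S" "S \<subseteq> M"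
    and T: "\<And>n. linear_on M (T n)" "\<And>n. positive_on M (T n)" "\<And>n. T n ` M \<subseteq> cts"
    and Tinf: "isometry_on M Tinf" "Tinf ` M \<subseteq> cts"
    and conv: "\<And>f. f \<in> S \<Longrightarrow> (\<lambda>n. supnorm (T n f - Tinf f)) \<longlonglongrightarrow> 0"
    and N: "lin_subspace N" "N \<subseteq> cts" "\<And>n. T n ` M \<subseteq> N" "Tinf ` M \<subseteq> N"
    and Ch: "choquet_boundary N \<subseteq> choquet_boundary (Tinf ` S)"
    and comp: "compact (choquet_boundary (Tinf ` S)) \<or> compact (choquet_boundary N)"
    and f: "f \<in> M"
  shows "(\<lambda>n. supnorm (T n f - Tinf f)) \<longlonglongrightarrow> 0"
proof -
  have S': "lin_subspace S" "S \<subseteq> cts" "(\<lambda>x. 1) \<in> S" and one: "(\<lambda>x. 1) \<in> M"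
    using S M(2) by (auto simp: function_space_def)
  have T_add: "T n (g + h) = T n g + T n h" if "g \<in> M" "h \<in> M" for n g h
    using T(1) that by (simp add: linear_on_def)
  have T_scale: "T n (\<lambda>x. k * g x) = (\<lambda>y. k * T n g y)" if "g \<in> M" for n k g
    using T(1) that by (simp add: linear_on_def)
  have T_re: "0 \<le> re (T n g y)" if "g \<in> M" "\<And>x. 0 \<le> re (g x)" for n g y
    by (rule positive_on_re[OF X M(1,2) one M(3) T(1,2) that])
  have diff_N: "T n g - Tinf g \<in> N" if "g \<in> M" for n g
    using that N by (intro lin_subspace_diff) auto
  have diff_le: "norm (T n g y - Tinf g y) \<le> supnorm (T n g - Tinf g)" if "g \<in> M" for n g y
    using norm_le_supnorm[OF Y, of "T n g - Tinf g" y] diff_N[OF that] N(2) by auto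
  have lim: "(\<lambda>n. T n s y) \<longlonglongrightarrow> Tinf s y" if s: "s \<in> S" for s y
  proof (rule Lim_null_comparison[THEN LIM_zero_cancel])
    show "\<forall>\<^sub>F n in sequentially. norm (T n s y - Tinf s y) \<le> supnorm (T n s - Tinf s)"
      using s S(2) by (intro always_eventually allI diff_le) auto
  qed (rule conv[OF s])
  have Tinf_add: "Tinf (s + s') = Tinf s + Tinf s'" if s: "s \<in> S" "s' \<in> S" for s s'
  proof
    fix y
    have "(\<lambda>n. T n (s + s') y) \<longlonglongrightarrow> Tinf s y + Tinf s' y"
      using tendsto_add[OF lim[OF s(1)] lim[OF s(2)], of y y] s S(2) by (simp add: T_add subsetD)
    from LIMSEQ_unique[OF lim[OF lin_subspace_add[OF S'(1) s]] this]
    show "Tinf (s + s') y = (Tinf s + Tinf s') y" by simp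
  qed
  have Tinf_scale: "Tinf (\<lambda>x. k * s x) = (\<lambda>y. k * Tinf s y)" if s: "s \<in> S" for k s
  proof
    fix y
    have "(\<lambda>n. T n (\<lambda>x. k * s x) y) \<longlonglongrightarrow> k * Tinf s y"
      using tendsto_mult_left[OF lim[OF s], of k y] s S(2) by (simp add: T_scale subsetD)
    with lim[OF lin_subspace_scale[OF S'(1) s]] show "Tinf (\<lambda>x. k * s x) y = k * Tinf s y"
      by (rule LIMSEQ_unique)
  qed
  have zero: "(\<lambda>x. 0) \<in> M" using M(1) by (simp add: lin_subspace_def)
  \<comment> \<open>Homogeneity on \<open>S\<close> gives that 0 is fixed, so the
    distance-preserving map also preserves norms.\<close>
  have "Tinf (\<lambda>x. 0) = (\<lambda>y. 0)" using Tinf_scale[OF S'(3), of 0] by simp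
  then have Tinf_norm: "supnorm (Tinf g) = supnorm g" if "g \<in> M" for g
    using Tinf(1) that zero by (fastforce simp: isometry_on_def supnorm_def)
  have Tinf_re: "0 \<le> re (Tinf s y)" if s: "s \<in> S" "\<And>x. 0 \<le> re (s x)" for s y
  proof (rule LIMSEQ_le_const)
    show "(\<lambda>n. re (T n s y)) \<longlonglongrightarrow> re (Tinf s y)"
      by (rule bounded_linear.tendsto[OF bounded_linear_re lim[OF s(1)]])
    show "\<exists>N. \<forall>n\<ge>N. 0 \<le> re (T n s y)"
      using s S(2) T_re by blast
  qed
  have point: "\<exists>x. (\<forall>g\<in>M. Tinf g y = g x) \<and>
      (\<forall>h\<in>cts. \<forall>e>0. \<exists>s\<in>S. (\<forall>z. h z \<le> re (s z)) \<and> re (s x) < h x + e)"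
    if y: "y \<in> choquet_boundary (Tinf ` S)" for y
  proof -
    have ext: "extreme_dual S (\<lambda>s. Tinf s y)"
    proof (rule extreme_dual_isometry[OF X S'(1,2) Tinf_add Tinf_scale])
      show "supnorm (Tinf s) = supnorm s" if "s \<in> S" for s
        using Tinf_norm that S(2) by blast
      show "extreme_dual (Tinf ` S) (\<lambda>g. g y)" using y by (simp add: choquet_boundary_def)
    qed
    have F1: "Tinf (\<lambda>x. 1) y = 1"
      by (rule extreme_positive_normalized[OF X S' ext Tinf_re])
    obtain x where x: "\<And>s. s \<in> S \<Longrightarrow> Tinf s y = s x"
      "\<And>h e. h \<in> cts \<Longrightarrow> e > 0 \<Longrightarrow> \<exists>s\<in>S. (\<forall>z. h z \<le> re (s z)) \<and> re (s x) < h x + e"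
      using extreme_state_envelope[OF X S(1) ext F1 Tinf_re] by metis
    have "Tinf g y = g x" if g: "g \<in> M" for g
    proof (rule lipschitz_evaluation[OF X M(1,2) S'(1,3) S(2) _ _ x(2) g])
      fix g h assume gh: "g \<in> M" "h \<in> M"
      have "Tinf g - Tinf h \<in> cts"
        using Tinf(2) gh by (intro lin_subspace_diff lin_subspace_cts) auto
      then have "norm ((Tinf g - Tinf h) y) \<le> supnorm (Tinf g - Tinf h)"
        by (rule norm_le_supnorm[OF Y])
      also have "\<dots> = supnorm (g - h)" using Tinf(1) gh by (simp add: isometry_on_def)
      finally show "norm (Tinf g y - Tinf h y) \<le> supnorm (g - h)" by simp
    qed (rule x(1))
    with x(2) show ?thesis by blast
  qed
  \<comment> \<open>The product filter records that the bound holds jointly for large indices and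
    for points near \<open>y\<close>; a bound at \<open>y\<close> alone could not be spread over
    \<open>K\<close>.\<close>
  have upper: "\<forall>\<^sub>F z in sequentially \<times>\<^sub>F nhds y.
      re (k * T (fst z) f (snd z)) \<le> re (k * Tinf f (snd z)) + e"
    if y: "y \<in> choquet_boundary (Tinf ` S)" and e: "e > 0" for y k e
  proof -
    obtain x where x: "\<And>g. g \<in> M \<Longrightarrow> Tinf g y = g x"
      "\<And>h e. h \<in> cts \<Longrightarrow> e > 0 \<Longrightarrow> \<exists>s\<in>S. (\<forall>z. h z \<le> re (s z)) \<and> re (s x) < h x + e"
      using point[OF y] by blast
    have kf: "(\<lambda>x. k * f x) \<in> M" by (rule lin_subspace_scale[OF M(1) f])
    then have "(\<lambda>x. re (k * f x)) \<in> cts" using cts_re M(2) by blast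
    \<comment> \<open>Four errors of \<open>e / 4\<close> add up to \<open>e\<close>: the envelope
      at \<open>x\<close>, the convergence on \<open>s\<close>, and the continuity at
      \<open>y\<close> of \<open>Tinf s\<close> and of \<open>k * Tinf f\<close>.\<close>
    from x(2)[OF this, of "e / 4"] e obtain s where s: "s \<in> S" "\<And>z. re (k * f z) \<le> re (s z)"
      "re (s x) < re (k * f x) + e / 4" by auto
    have sM: "s \<in> M" using s(1) S(2) by blast
    have s_cts: "continuous_on UNIV (\<lambda>z. re (Tinf s z))"
      using cts_re[of "Tinf s"] Tinf(2) sM by (auto simp: cts_def)
    have f_cts: "continuous_on UNIV (\<lambda>z. re (k * Tinf f z))"
      using cts_re[of "\<lambda>z. k * Tinf f z"] lin_subspace_scale[OF lin_subspace_cts, of "Tinf f" k]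
        Tinf(2) f by (auto simp: cts_def)
    define U where "U = {z. re (Tinf s z) < re (Tinf s y) + e / 4} \<inter>
      {z. re (k * Tinf f y) - e / 4 < re (k * Tinf f z)}"
    have "open U"
      unfolding U_def by (intro open_Int open_Collect_less s_cts f_cts continuous_intros)
    moreover have "y \<in> U" using e by (simp add: U_def)
    ultimately have "\<forall>\<^sub>F z in nhds y. z \<in> U" by (rule eventually_nhds_in_open)
    moreover have "\<forall>\<^sub>F n in sequentially. supnorm (T n s - Tinf s) < e / 4"
      using order_tendstoD(2)[OF conv[OF s(1)], of "e / 4"] e by simp
    ultimately have "\<forall>\<^sub>F z in sequentially \<times>\<^sub>F nhds y.
        supnorm (T (fst z) s - Tinf s) < e / 4 \<and> snd z \<in> U"
      by (intro eventually_prodI)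
    then show ?thesis
    proof eventually_elim
      case (elim z)
      define n y' where "n = fst z" and "y' = snd z"
      have "0 \<le> re (T n (s + (\<lambda>x. (- 1) * (k * f x))) y')"
        using s(2) by (intro T_re lin_subspace_add lin_subspace_scale M(1) sM kf) (simp add: re_diff)
      then have "re (k * T n f y') \<le> re (T n s y')"
        using T_scale[OF kf, of n "- 1"] T_scale[OF f, of n k]
          T_add[OF sM lin_subspace_scale[OF M(1) kf, of "- 1"], of n] by (simp add: re_diff)
      also have "\<dots> \<le> re (Tinf s y') + e / 4"
        using abs_re_le[of "T n s y' - Tinf s y'"] diff_le[OF sM, of n y'] elim
        by (auto simp: re_diff n_def)
      also have "\<dots> \<le> re (k * Tinf f y') + e"
        using elim s(3) by (simp add: U_def y'_def x(1)[OF sM] x(1)[OF f])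
      finally show ?case by (simp add: n_def y'_def)
    qed
  qed
  \<comment> \<open>The scalars 1, -1, \<open>c\<close>, \<open>- c\<close> bound both coordinates
    of the difference from both sides, each by \<open>e / 2\<close>.\<close>
  have loc: "\<forall>\<^sub>F z in sequentially \<times>\<^sub>F nhds y. norm (T (fst z) f (snd z) - Tinf f (snd z)) \<le> e"
    if y: "y \<in> choquet_boundary (Tinf ` S)" and e: "e > 0" for y e
    using upper[OF y half_gt_zero[OF e], of 1] upper[OF y half_gt_zero[OF e], of "- 1"]
      upper[OF y half_gt_zero[OF e], of c] upper[OF y half_gt_zero[OF e], of "- c"]
  proof eventually_elim
    case (elim z)
    define d where "d = T (fst z) f (snd z) - Tinf f (snd z)"
    have "\<bar>re d\<bar> \<le> e / 2" "\<bar>re (c * d)\<bar> \<le> e / 2"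
      using elim unfolding abs_le_iff by (simp_all add: d_def re_diff right_diff_distrib re_minus)
    then show ?case using norm_le_re[of d] by (simp add: d_def)
  qed
  \<comment> \<open>\<open>K\<close> is whichever of the two boundaries is compact: it must contain
    the norming set Ch(N) and consist of points at which the local estimate is available.\<close>
  obtain K where K: "compact K" "choquet_boundary N \<subseteq> K" "K \<subseteq> choquet_boundary (Tinf ` S)"
    using comp Ch by blast
  have ev: "\<forall>\<^sub>F n in sequentially. supnorm (T n f - Tinf f) \<le> e" if e: "e > 0" for e
  proof -
    have "\<exists>U. open U \<and> y \<in> U \<and>
        (\<forall>\<^sub>F n in sequentially. \<forall>y'\<in>U. norm (T n f y' - Tinf f y') \<le> e)" if "y \<in> K" for y
    proof -
      have "y \<in> choquet_boundary (Tinf ` S)" using that K(3) by blast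
      from loc[OF this e] obtain P Q where P: "eventually P sequentially" and "eventually Q (nhds y)"
        and PQ: "\<And>n y'. P n \<Longrightarrow> Q y' \<Longrightarrow> norm (T n f y' - Tinf f y') \<le> e"
        unfolding eventually_prod_filter by auto
      then obtain U where U: "open U" "y \<in> U" "\<And>y'. y' \<in> U \<Longrightarrow> Q y'"
        unfolding eventually_nhds by blast
      moreover have "\<forall>\<^sub>F n in sequentially. \<forall>y'\<in>U. norm (T n f y' - Tinf f y') \<le> e"
        using P by eventually_elim (use PQ U(3) in blast)
      ultimately show ?thesis by blast
    qed
    then have "\<forall>y\<in>K. \<exists>U. open U \<and> y \<in> U \<and>
        (\<forall>\<^sub>F n in sequentially. \<forall>y'\<in>U. norm (T n f y' - Tinf f y') \<le> e)" by (rule ballI)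
    from bchoice[OF this] obtain U where U: "\<And>y. y \<in> K \<Longrightarrow> open (U y)" "\<And>y. y \<in> K \<Longrightarrow> y \<in> U y"
      "\<And>y. y \<in> K \<Longrightarrow> \<forall>\<^sub>F n in sequentially. \<forall>y'\<in>U y. norm (T n f y' - Tinf f y') \<le> e"
      by blast
    have "K \<subseteq> (\<Union>y\<in>K. U y)" using U(2) by blast
    from compactE_image[OF K(1) U(1) this]
    obtain K' where K': "K' \<subseteq> K" "finite K'" "K \<subseteq> (\<Union>y\<in>K'. U y)" .
    have "\<forall>\<^sub>F n in sequentially. \<forall>y\<in>K'. \<forall>y'\<in>U y. norm (T n f y' - Tinf f y') \<le> e"
      using K'(1,2) U(3) by (intro eventually_ball_finite) auto
    then show ?thesis
    proof eventually_elim
      case (elim n)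
      obtain y where y: "y \<in> choquet_boundary N" "supnorm (T n f - Tinf f) \<le> norm ((T n f - Tinf f) y)"
        by (rule choquet_boundary_norming[OF Y N(1,2) diff_N[OF f]])
      then obtain y0 where "y0 \<in> K'" "y \<in> U y0" using K(2) K'(3) by blast
      then have "norm (T n f y - Tinf f y) \<le> e" using elim by blast
      with y(2) show ?case by simp
    qed
  qed
  show ?thesis
  proof (rule tendstoI)
    fix e :: real assume "e > 0"
    then have "\<forall>\<^sub>F n in sequentially. supnorm (T n f - Tinf f) \<le> e / 2" by (intro ev) simp
    then show "\<forall>\<^sub>F n in sequentially. dist (supnorm (T n f - Tinf f)) 0 < e"
    proof eventually_elim
      case (elim n)
      have "0 \<le> supnorm (T n f - Tinf f)"
        using diff_N[OF f] N(2) by (intro supnorm_nonneg[OF Y]) auto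
      with elim \<open>e > 0\<close> show ?case by simp
    qed
  qed
qed

lemma thm32_claim_holds:
  assumes "compact (UNIV :: 'a::t2_space set)" "compact (UNIV :: 'b::t2_space set)"
  shows "thm32_claim cj TYPE('a) TYPE('b)"
  unfolding thm32_claim_def
proof (intro allI impI ballI, elim conjE)
  fix M S and T :: "nat \<Rightarrow> ('a \<Rightarrow> 'k) \<Rightarrow> ('b \<Rightarrow> 'k)" and Tinf f
  let ?A = "(\<Union>n. T n ` M) \<union> Tinf ` M"
  assume M: "lin_subspace M" "M \<subseteq> cts" "self_conjugate cj M" and S: "function_space S" "S \<subseteq> M"
    and T: "\<forall>n. linear_on M (T n) \<and> positive_on M (T n) \<and> T n ` M \<subseteq> cts"
    and Tinf: "isometry_on M Tinf" "Tinf ` M \<subseteq> cts"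
    and conv: "\<forall>f\<in>S. (\<lambda>n. supnorm (T n f - Tinf f)) \<longlonglongrightarrow> 0"
    and Ch: "choquet_boundary (kspan ?A) \<subseteq> choquet_boundary (Tinf ` S)"
      "compact (choquet_boundary (Tinf ` S)) \<or> compact (choquet_boundary (kspan ?A))"
    and f: "f \<in> M"
  have T': "linear_on M (T n)" "positive_on M (T n)" "T n ` M \<subseteq> cts" for n
    using T by simp_all
  have "?A \<subseteq> cts" using T'(3) Tinf(2) by blast
  then have N: "kspan ?A \<subseteq> cts" by (rule kspan_subset_cts)
  have TN: "T n ` M \<subseteq> kspan ?A" "Tinf ` M \<subseteq> kspan ?A" for n
    using subset_kspan[of ?A] by blast+
  show "(\<lambda>n. supnorm (T n f - Tinf f)) \<longlonglongrightarrow> 0"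
    by (rule korovkin_isometry[OF assms M S T' Tinf bspec[OF conv] lin_subspace_kspan N TN Ch f])
qed

end

theorem theorem3p2:
  assumes "compact (UNIV :: 'a::t2_space set)"
      and "compact (UNIV :: 'b::t2_space set)"
  shows "thm32_claim (\<lambda>z::real. z) TYPE('a) TYPE('b) \<and> thm32_claim (cnj :: complex \<Rightarrow> complex) TYPE('a) TYPE('b)"
proof
  interpret real: scalars "\<lambda>z::real. z" "\<lambda>z. z" 0
    by unfold_locales simp_all
  show "thm32_claim (\<lambda>z::real. z) TYPE('a) TYPE('b)" by (rule real.thm32_claim_holds[OF assms])
  interpret complex: scalars Re cnj \<i>
    by unfold_locales (simp_all add: complex_add_cnj cmod_power2)
  show "thm32_claim (cnj :: complex \<Rightarrow> complex) TYPE('a) TYPE('b)" by (rule complex.thm32_claim_holds[OF assms])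
qed

end
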